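(* Let $\ell_n$ denote the $n$th lucky number. Then the inequality $$\ell_n < n \big(\log n + \tfrac12(\log\log n)^2 + 1\big)$$ holds for all integers $n \in [4, 10^7]$; and the inequality $$\ell_n < n \big(\log n + \tfrac12(\log\log n)^2 + 1.239\,\log\log n + 3.016\big)$$ holds for all integers $n > 10^7$.
   Context: $\log$ is the natural logarithm. Lucky numbers: let $\mathcal{L}_1$ be the set of all positive integers and let $\mathcal{L}_2$ be the set consisting of the number $2$ and all odd integers $\geq 3$. For every integer $m \geq 1$ let $(\ell_{m,n})_{n \geq 1}$ be the elements of $\mathcal{L}_m$ listed in increasing order. For every integer $m \geq 2$, recursively, $\mathcal{L}_{m+1}$ is the set of all $\ell_{m,n}$ such that $n$ is a positive integer not divisible by $\ell_{m,m}$. The lucky numbers are $\ell_1 := 2$ (by convention) and $\ell_n := \ell_{n,n}$ for every integer $n \geq 2$ (so $\ell_2 = 3$, $\ell_3 = 7$, $\ell_4 = 9$, $\ell_5 = 13$, ...). *)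

theory Defs
  imports Complex_Main "HOL-Library.Infinite_Set"
begin

text \<open>The library's \<^const>\<open>enumerate\<close> counts from \<open>0\<close>; \<open>nth_elem S n\<close> is the
  \<open>n\<close>-th smallest element of the infinite set \<open>S\<close> for \<open>n \<ge> 1\<close>.\<close>

definition nth_elem :: "nat set \<Rightarrow> nat \<Rightarrow> nat" where
  "nth_elem S n = enumerate S (n - 1)"

text \<open>The index starts at \<open>1\<close>; the value at index \<open>0\<close> is a dummy that nothing refers to.
  In the last equation \<open>Suc (Suc m)\<close> ranges over the indices \<open>\<ge> 2\<close>.\<close>

fun lucky_sieve :: "nat \<Rightarrow> nat set" where
  "lucky_sieve 0 = {}"
| "lucky_sieve (Suc 0) = {k. 1 \<le> k}"
| "lucky_sieve (Suc (Suc 0)) = insert 2 {k. odd k \<and> 3 \<le> k}"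
| "lucky_sieve (Suc (Suc (Suc m))) =
     {nth_elem (lucky_sieve (Suc (Suc m))) n | n.
        1 \<le> n \<and> \<not> nth_elem (lucky_sieve (Suc (Suc m))) (Suc (Suc m)) dvd n}"

definition lucky :: "nat \<Rightarrow> nat" where
  "lucky n = (if n = 1 then 2 else nth_elem (lucky_sieve n) n)"

end

(* Going back through the sieve, an element at position k (counted from 0) after the m-th stage was
   at position k + floor(k / (l_m - 1)) before it.  Hence l_n - 1 <= (n - 1) W(i), where
   W(i) is the product of 1 + 1/(l_m - 1) over m <= i and i is the largest index with l_i <= n,
   and l_n - 1 >= (n - p) W(p) for 1 <= p < n.  Since W grows by the factor 1 + 1/(l_n - 1) at n,
   lower bounds for l_n turn into upper bounds for W.

   Up to n = 3676350 the values of l_n and W(n) are enclosed on a grid of 269 indices (all n <= 70,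
   then a geometric progression), each row being verified from the earlier ones; this bounds
   W(i) by the first expression as long as l_i <= 10^7.  Beyond the grid, taking p maximal with
   p W(p) <= n gives (n - 1) (W(n) - W(n - 1)) <= 1 + (log y + 2.2)/y with y = W(n - 1) - 13
   by induction, and integrating with W(n) >= log n + 6 gives the second bound. *)
theory Submission imports Defs
begin

section \<open>Positions in the sieve\<close>

text \<open>Dropping the stages after p costs p W(p) <= n, so l_n - 1 >= n (W(p) - 1): only 1 is
  lost from W(p). Maximality of p makes n / p about W(p), and W grows roughly like log, so W(n - 1)
  exceeds W(p) by about log W(p). Hence (n - 1) W(n - 1) / (l_n - 1) is roughly 1 + (log W + 1) / W;
  the constants 2.2 and 13 leave the room that closes the induction.

  This induction looks back by a factor W, so its base is a whole window of indices: from 187404,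
  where W exceeds 18, to 3676350, which is at least 187404 W(187404). The first bound uses the grid
  up to 642057, where l exceeds 10^7; the higher rows serve the window.

  For small n the comparison of W(i) with the first bound fails: n = 9 has i = 4 and W(4) = 3.9375,
  but log n + (log log n)^2 / 2 + 1 is about 3.51. So all n <= 62 are checked one by one with exact
  values.

  In the second bound, n >= l_i and l_i is at least about i log i / 1.6, so log n >= log i + log log
  i - 0.6. This absorbs one log log, turning the coefficient 2.2 from the integration into 1.2 <
  1.239.\<close>

lemma enumerate_eqI:
  fixes f :: "nat \<Rightarrow> nat"
  assumes "strict_mono f" "range f = S"
  shows "enumerate S = f"
proof -
  have inf: "infinite S"
    using assms range_inj_infinite strict_mono_imp_inj_on by blast
  have "enumerate S n = f n" for n
  proof (induction n rule: less_induct)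
    case (less n)
    have "f n \<in> S" using assms by auto
    then obtain m where m: "enumerate S m = f n"
      using enumerate_Ex inf by metis
    obtain k where k: "enumerate S n = f k"
      using enumerate_in_set[OF inf, of n] assms by auto
    have "\<not> m < n"
      using less.IH[of m] m assms(1) by (auto simp: strict_mono_eq)
    moreover have "\<not> k < n"
      using less.IH[of k] k inf by (metis enumerate_mono less_irrefl)
    ultimately show ?case
      using k m assms(1) inf
      by (metis enumerate_mono_le_iff le_antisym not_less strict_mono_less_eq)
  qed
  then show ?thesis by blast
qed

definition skip :: "nat \<Rightarrow> nat \<Rightarrow> nat" where
  "skip d z = z + z div d"

lemma skip_ge: "z \<le> skip d z"
  by (simp add: skip_def)

lemma strict_mono_skip: "strict_mono (skip d)"
  by (auto simp: skip_def strict_mono_def intro!: add_less_le_mono div_le_mono)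

text \<open>Positions are counted from \<open>0\<close>, so deleting every \<open>(d+1)\<close>-st element keeps the
  positions \<open>k\<close> with \<open>\<not> Suc d dvd Suc k\<close>.\<close>

lemma range_skip:
  assumes "d \<ge> 1"
  shows "range (skip d) = {k. \<not> Suc d dvd Suc k}"
proof (intro set_eqI iffI)
  fix k assume "k \<in> range (skip d)"
  then obtain z where "k = skip d z" by auto
  then have "Suc k = z div d * Suc d + Suc (z mod d)"
    by (simp add: skip_def algebra_simps)
  moreover have "Suc (z mod d) < Suc d" using assms by simp
  ultimately have "Suc k mod Suc d = Suc (z mod d)"
    by (metis mod_less mod_mult_self3)
  then show "k \<in> {k. \<not> Suc d dvd Suc k}" by (simp add: dvd_eq_mod_eq_0)
next
  fix k assume "k \<in> {k. \<not> Suc d dvd Suc k}"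
  then have "Suc k mod Suc d \<noteq> 0" by (simp add: dvd_eq_mod_eq_0)
  then obtain r where r: "Suc k mod Suc d = Suc r" using not0_implies_Suc by blast
  have rd: "r < d" using mod_less_divisor[of "Suc d" "Suc k"] r by simp
  define q where "q = Suc k div Suc d"
  have "Suc k = q * Suc d + Suc r"
    unfolding q_def r[symmetric] by (metis div_mult_mod_eq)
  then have "k = skip d (q * d + r)"
    using rd assms by (simp add: skip_def algebra_simps)
  then show "k \<in> range (skip d)" by blast
qed

text \<open>One less than a lucky number plays two roles: it is the divisor in \<open>skip\<close>,
  and it is the position of that number, counted from 0, among all positive integers.\<close>

definition lk :: "nat \<Rightarrow> nat" where
  "lk n = lucky n - 1"

text \<open>Undoes the stages \<open>v\<close>, ..., \<open>u + 1\<close>, the latest first: a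
  position after stage \<open>v\<close> becomes one after stage \<open>u\<close>. For
  \<open>v < u\<close> there is nothing to undo.\<close>

fun pos :: "nat \<Rightarrow> nat \<Rightarrow> nat \<Rightarrow> nat" where
  "pos u 0 z = z"
| "pos u (Suc v) z = (if v < u then z else pos u v (skip (lk (Suc v)) z))"

lemma pos_refl: "v \<le> u \<Longrightarrow> pos u v z = z"
  by (cases v) auto

lemma pos_ge: "z \<le> pos u v z"
proof (induction v arbitrary: z)
  case (Suc v)
  then show ?case
    using skip_ge order_trans by (simp, blast)
qed simp

lemma strict_mono_pos: "strict_mono (pos u v)"
proof (induction v)
  case (Suc v)
  have "strict_mono (pos u v \<circ> skip (lk (Suc v)))"
    by (intro strict_mono_o Suc.IH strict_mono_skip)
  then show ?case by (auto simp: strict_mono_def)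
qed (simp add: strict_mono_def)

lemma pos_mono: "z \<le> z' \<Longrightarrow> pos u v z \<le> pos u v z'"
  using strict_mono_pos by (simp add: strict_mono_less_eq)

lemma pos_pos: "u \<le> w \<Longrightarrow> w \<le> v \<Longrightarrow> pos u w (pos w v z) = pos u v z"
proof (induction v arbitrary: z)
  case (Suc v)
  then show ?case
    by (cases "w = Suc v") (auto simp: pos_refl)
qed simp

lemma lucky_sieve_2: "lucky_sieve 2 = insert 2 {k. odd k \<and> 3 \<le> k}"
  by (rule lucky_sieve.simps(3)[folded numeral_2_eq_2])

lemma enumerate_sieve_2: "enumerate (lucky_sieve 2) z = (if z = 0 then 2 else 2 * z + 1)"
proof -
  have "enumerate (lucky_sieve 2) = (\<lambda>z. if z = 0 then 2 else 2 * z + 1)"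
  proof (rule enumerate_eqI)
    show "strict_mono (\<lambda>z::nat. if z = 0 then 2 else 2 * z + 1 :: nat)"
      by (auto simp: strict_mono_def)
    show "range (\<lambda>z::nat. if z = 0 then 2 else 2 * z + 1 :: nat) = lucky_sieve 2"
    proof (intro set_eqI iffI)
      fix x :: nat assume "x \<in> lucky_sieve 2"
      then consider "x = 2" | "odd x" "x \<ge> 3" by (auto simp: lucky_sieve_2)
      then show "x \<in> range (\<lambda>z::nat. if z = 0 then 2 else 2 * z + 1)"
      proof cases
        case 1
        then show ?thesis by (intro range_eqI[of _ _ 0]) auto
      next
        case 2
        then obtain k where "x = 2 * k + 1" by (auto elim: oddE)
        with 2 show ?thesis by (intro range_eqI[of _ _ k]) auto
      qed
    qed (auto simp: lucky_sieve_2)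
  qed
  then show ?thesis by simp
qed

lemma enumerate_sieve:
  "enumerate (lucky_sieve (Suc (Suc m))) z = enumerate (lucky_sieve 2) (pos 1 (Suc m) z)"
proof (induction m arbitrary: z)
  case 0
  then show ?case by (simp add: pos_refl numeral_2_eq_2)
next
  case (Suc m)
  let ?S = "lucky_sieve (Suc (Suc m))" and ?d = "lucky (Suc (Suc m))"
  have sm2: "strict_mono (enumerate (lucky_sieve 2))"
    by (auto simp: strict_mono_def enumerate_sieve_2)
  have smS: "strict_mono (enumerate ?S)"
    using strict_mono_o[OF sm2 strict_mono_pos] Suc.IH by (simp add: strict_mono_def del: pos.simps)
  have d: "?d = nth_elem ?S (Suc (Suc m))" by (simp add: lucky_def)
  also have "\<dots> \<ge> 2" by (simp add: nth_elem_def Suc.IH enumerate_sieve_2)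
  finally have d1: "?d - 1 \<ge> 1" and d2: "Suc (?d - 1) = ?d" by simp_all
  have "enumerate (lucky_sieve (Suc (Suc (Suc m)))) = enumerate ?S \<circ> skip (?d - 1)"
  proof (rule enumerate_eqI)
    show "strict_mono (enumerate ?S \<circ> skip (?d - 1))"
      by (intro strict_mono_o smS strict_mono_skip)
    have "range (enumerate ?S \<circ> skip (?d - 1)) = enumerate ?S ` {k. \<not> ?d dvd Suc k}"
      using range_skip[OF d1] d2 by (metis image_comp)
    also have "\<dots> = lucky_sieve (Suc (Suc (Suc m)))"
      unfolding lucky_sieve.simps d
    proof (intro set_eqI iffI)
      fix x assume "x \<in> enumerate ?S ` {k. \<not> nth_elem ?S (Suc (Suc m)) dvd Suc k}"
      then obtain k where "x = enumerate ?S k" "\<not> nth_elem ?S (Suc (Suc m)) dvd Suc k" by blast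
      then show "x \<in> {nth_elem ?S n |n. 1 \<le> n \<and> \<not> nth_elem ?S (Suc (Suc m)) dvd n}"
        by (intro CollectI exI[of _ "Suc k"]) (simp add: nth_elem_def)
    next
      fix x assume "x \<in> {nth_elem ?S n |n. 1 \<le> n \<and> \<not> nth_elem ?S (Suc (Suc m)) dvd n}"
      then obtain n where n: "x = nth_elem ?S n" "1 \<le> n" "\<not> nth_elem ?S (Suc (Suc m)) dvd n"
        by blast
      then have "Suc (n - 1) = n" by simp
      with n show "x \<in> enumerate ?S ` {k. \<not> nth_elem ?S (Suc (Suc m)) dvd Suc k}"
        by (intro image_eqI[of _ _ "n - 1"]) (auto simp: nth_elem_def)
    qed
    finally show "range (enumerate ?S \<circ> skip (?d - 1)) = lucky_sieve (Suc (Suc (Suc m)))" .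
  qed
  then show ?case using Suc.IH by (simp add: lk_def)
qed

lemma lucky_1: "lucky 1 = 2"
  by (simp add: lucky_def)

text \<open>Stage 1 fits the scheme: \<open>lk 1 = 1\<close> makes \<open>skip\<close> double a
  position, which yields 1, 3, 5, ..., and the set of index 2 is this sequence with 1 replaced by 2.
  The replaced element sits at position 0, which is not met for \<open>n >= 2\<close>.\<close>

lemma lucky_pos:
  assumes "n \<ge> 2"
  shows "lucky n = Suc (pos 0 (n - 1) (n - 1))"
proof -
  obtain m where m: "n = Suc (Suc m)"
    using assms by (metis Suc_le_D numeral_2_eq_2 Suc_le_mono)
  have "pos 1 (Suc m) (Suc m) \<ge> 1"
    using pos_ge[of "Suc m" 1 "Suc m"] by linarith
  then have "lucky n = 2 * pos 1 (Suc m) (Suc m) + 1"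
    by (simp add: lucky_def m nth_elem_def enumerate_sieve enumerate_sieve_2 del: pos.simps)
  also have "2 * pos 1 (Suc m) (Suc m) = pos 0 1 (pos 1 (Suc m) (Suc m))"
    using lucky_1 by (simp add: skip_def lk_def)
  also have "\<dots> = pos 0 (Suc m) (Suc m)"
    by (intro pos_pos) auto
  finally show ?thesis by (simp add: m)
qed

section \<open>The product \<open>W\<close>\<close>

lemma lk_1: "lk (Suc 0) = 1"
  using lucky_1 by (simp add: lk_def)

lemma lk_pos: "n \<ge> 2 \<Longrightarrow> lk n = pos 0 (n - 1) (n - 1)"
  by (simp add: lk_def lucky_pos)

lemma lucky_lk: "n \<ge> 1 \<Longrightarrow> lucky n = Suc (lk n)"
proof (cases "n = 1")
  case False
  moreover assume "n \<ge> 1"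
  ultimately show ?thesis by (simp add: lk_def lucky_pos)
qed (use lucky_1 in \<open>simp add: lk_def\<close>)

lemma lk_less_Suc:
  assumes "n \<ge> 1"
  shows "lk n < lk (Suc n)"
proof (cases "n = 1")
  case True
  then show ?thesis using lk_1 lk_pos[of 2] by (simp add: skip_def numeral_2_eq_2)
next
  case False
  then obtain m where m: "n = Suc m" "m \<ge> 1" using assms by (cases n) auto
  have "lk n = pos 0 m m" using m by (simp add: lk_pos)
  also have "\<dots> < pos 0 m n" using strict_mono_pos m by (simp add: strict_mono_less)
  also have "\<dots> \<le> pos 0 m (skip (lk n) n)" by (intro pos_mono skip_ge)
  also have "\<dots> = lk (Suc n)" using m by (simp add: lk_pos)
  finally show ?thesis .
qed

lemma lk_less: "1 \<le> m \<Longrightarrow> m < n \<Longrightarrow> lk m < lk n"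
proof (induction n)
  case (Suc n)
  then show ?case using lk_less_Suc[of n] by (cases "m = n") auto
qed simp

lemma lk_mono: "1 \<le> m \<Longrightarrow> m \<le> n \<Longrightarrow> lk m \<le> lk n"
  using lk_less[of m n] by (cases "m = n") auto

lemma lk_add_le: "1 \<le> m \<Longrightarrow> lk m + t \<le> lk (m + t)"
proof (induction t)
  case (Suc t)
  then show ?case using lk_less_Suc[of "m + t"] by simp
qed simp

lemma lk_ge: "n \<ge> 1 \<Longrightarrow> n \<le> lk n"
  using lk_add_le[of 1 "n - 1"] lk_1 by simp

definition W :: "nat \<Rightarrow> real" where
  "W n = (\<Prod>m = 1..n. 1 + 1 / lk m)"

lemma W_0: "W 0 = 1"
  by (simp add: W_def)

lemma W_Suc: "W (Suc n) = W n * (1 + 1 / lk (Suc n))"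
  by (simp add: W_def)

lemma W_1: "W (Suc 0) = 2"
  by (simp add: W_Suc W_0 lk_1)

lemma W_ge_1: "1 \<le> W n"
  unfolding W_def by (intro prod_ge_1) simp

lemma W_pos: "0 < W n"
  using W_ge_1[of n] by linarith

lemma W_mono: "m \<le> n \<Longrightarrow> W m \<le> W n"
proof (induction n)
  case (Suc n)
  have "W n \<le> W (Suc n)"
    using W_pos[of n] by (simp add: W_Suc field_simps)
  then show ?case using Suc by (cases "m = Suc n") auto
qed simp

lemma W_ge_2: "n \<ge> 1 \<Longrightarrow> 2 \<le> W n"
  using W_mono[of 1 n] W_1 by simp

section \<open>Positions compared with the product, and positions across blocks of stages\<close>

lemma real_skip_le: "real (skip d z) \<le> real z * (1 + 1 / real d)"
proof -
  have "real (z div d) \<le> real z / real d" by (rule of_nat_div_le_of_nat)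
  then show ?thesis by (simp add: skip_def algebra_simps)
qed

lemma real_skip_ge:
  assumes "d \<ge> 1"
  shows "real (skip d z) + 2 \<ge> (real z + 1) * (1 + 1 / real d)"
proof -
  have "z mod d < d" using assms by simp
  then have "z + 1 \<le> d * (z div d) + d"
    using mult_div_mod_eq[of d z] by linarith
  then have "real (z + 1) \<le> real (d * (z div d) + d)" by (rule of_nat_mono)
  then have "(real z + 1) / real d \<le> real (z div d) + 1"
    using assms by (simp add: field_simps)
  then show ?thesis by (simp add: skip_def algebra_simps)
qed

lemma pos_le_W: "real (pos 0 u z) \<le> real z * W u"
proof (induction u arbitrary: z)
  case (Suc u)
  have "real (pos 0 (Suc u) z) \<le> real (skip (lk (Suc u)) z) * W u"
    using Suc.IH by simp
  also have "\<dots> \<le> real z * (1 + 1 / lk (Suc u)) * W u"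
    by (intro mult_right_mono real_skip_le less_imp_le[OF W_pos])
  finally show ?case by (simp add: W_Suc mult_ac)
qed (simp add: W_0)

text \<open>Each stage after the first costs at most one position by rounding, and the cost is
  charged to the starting position, where it is multiplied by all of \<open>W u\<close>. Stage 1
  doubles exactly, so only \<open>u - 1\<close> positions are lost and the induction starts at
  \<open>u = 1\<close>.\<close>

lemma W_le_pos: "u \<ge> 1 \<Longrightarrow> (real z + 1 - real u) * W u \<le> real (pos 0 u z)"
proof (induction u arbitrary: z rule: dec_induct)
  case base
  show ?case by (simp add: W_1 lk_1 skip_def)
next
  case (step u)
  let ?c = "1 + 1 / real (lk (Suc u))"
  have l: "lk (Suc u) \<ge> 1" using lk_ge[of "Suc u"] by simp
  have "(real z + 1 - real (Suc u)) * ?c = (real z + 1) * ?c - real (Suc u) * ?c"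
    by (rule left_diff_distrib)
  also have "\<dots> \<le> (real z + 1) * ?c - real (Suc u)"
    by (simp add: distrib_left)
  also have "\<dots> \<le> real (skip (lk (Suc u)) z) + 1 - real u"
    using real_skip_ge[OF l, of z] by simp
  finally have "(real z + 1 - real (Suc u)) * ?c * W u
      \<le> (real (skip (lk (Suc u)) z) + 1 - real u) * W u"
    by (intro mult_right_mono less_imp_le[OF W_pos])
  also have "\<dots> \<le> real (pos 0 (Suc u) z)"
    using step.IH by simp
  finally show ?case by (simp add: W_Suc mult_ac)
qed

lemma pos_ge_block:
  assumes "\<And>m. u < m \<Longrightarrow> m \<le> v \<Longrightarrow> lk m \<le> M"
  shows "z + z div M * (v - u) \<le> pos u v z"
  using assms
proof (induction v arbitrary: z)
  case (Suc v)
  show ?case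
  proof (cases "v < u")
    case False
    have l: "lk (Suc v) \<le> M" "lk (Suc v) > 0"
      using Suc.prems[of "Suc v"] False lk_ge[of "Suc v"] by auto
    let ?z = "skip (lk (Suc v)) z"
    have z: "z + z div M \<le> ?z"
      using l by (simp add: skip_def div_le_mono2)
    have "z + z div M * (Suc v - u) = z + z div M + z div M * (v - u)"
      using False by (simp add: Suc_diff_le)
    also have "\<dots> \<le> ?z + ?z div M * (v - u)"
      by (intro add_mono z mult_le_mono1 div_le_mono skip_ge)
    also have "\<dots> \<le> pos u v ?z"
      using Suc by auto
    finally show ?thesis using False by simp
  qed simp
qed simp

text \<open>As long as all quotients are at most \<open>q\<close>, the position before the last
  undone stage is at most \<open>z + q * (v - u - 1)\<close>; the last hypothesis says that even
  there the quotient is at most \<open>q\<close>.\<close>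

lemma pos_le_block:
  assumes "\<And>m. u < m \<Longrightarrow> m \<le> v \<Longrightarrow> M \<le> lk m"
    and "u < v" "z + q * (v - u - 1) < (q + 1) * M"
  shows "pos u v z \<le> z + q * (v - u)"
  using assms
proof (induction v arbitrary: z)
  case (Suc v)
  have l: "M \<le> lk (Suc v)" "lk (Suc v) > 0"
    using Suc.prems(1)[of "Suc v"] Suc.prems(2) lk_ge[of "Suc v"] by auto
  have "z < (q + 1) * M" using Suc.prems(3) by linarith
  also have "\<dots> \<le> (q + 1) * lk (Suc v)" by (intro mult_le_mono2 l)
  finally have "z div lk (Suc v) < q + 1" using l by (simp add: less_mult_imp_div_less)
  then have z: "skip (lk (Suc v)) z \<le> z + q" by (simp add: skip_def)
  show ?case
  proof (cases "u = v")
    case True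
    then show ?thesis using z by (simp add: pos_refl)
  next
    case False
    then obtain k where k: "v = u + Suc k" using Suc.prems(2) less_iff_Suc_add by auto
    have "pos u v (z + q) \<le> z + q + q * (v - u)"
      using Suc.prems by (intro Suc.IH) (auto simp: k)
    then show ?thesis
      using pos_mono[OF z, of u v] by (simp add: k)
  qed
qed simp

lemma pos_eq_block:
  assumes "\<And>m. u < m \<Longrightarrow> m \<le> v \<Longrightarrow> z < lk m"
  shows "pos u v z = z"
proof (cases "u < v")
  case True
  have "pos u v z \<le> z + 0 * (v - u)"
    by (rule pos_le_block[where M = "Suc z"]) (use True assms in \<open>auto simp: Suc_le_eq\<close>)
  then show ?thesis using pos_ge[of z u v] by simp
qed (simp add: pos_refl)

lemma lk_ge_pos:
  assumes "u \<le> n" "n \<ge> 1"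
  shows "pos 0 u n \<le> lk (Suc n)"
proof -
  have "lk (Suc n) = pos 0 u (pos u n n)"
    using assms by (simp add: lk_pos pos_pos)
  then show ?thesis by (metis pos_ge pos_mono)
qed

lemma lk_le_W: "n \<ge> 1 \<Longrightarrow> lk (Suc n) \<le> real n * W n"
  using pos_le_W[of n n] by (simp add: lk_pos)

text \<open>Only the stages \<open>m\<close> with \<open>lucky m \<le> n\<close> move the \<open>n\<close>-th lucky number.\<close>

lemma lucky_less_W:
  assumes n: "n \<ge> 2" and i: "i \<ge> 1" "n < lucky (Suc i)"
  shows "lucky n < n * W i"
proof -
  have "pos (min i (n - 1)) (n - 1) (n - 1) = n - 1"
  proof (rule pos_eq_block)
    fix m assume m: "min i (n - 1) < m" "m \<le> n - 1"
    then have "lk (Suc i) \<le> lk m" by (intro lk_mono) auto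
    then show "n - 1 < lk m" using i n by (simp add: lucky_lk)
  qed
  then have "lk n = pos 0 (min i (n - 1)) (n - 1)"
    using n by (metis lk_pos pos_pos min.cobounded2 le0)
  then have "lk n \<le> real (n - 1) * W (min i (n - 1))"
    using pos_le_W by metis
  also have "\<dots> \<le> real (n - 1) * W i"
    by (intro mult_left_mono W_mono) auto
  also have "\<dots> = n * W i - W i"
    using n by (simp add: of_nat_diff algebra_simps)
  finally show ?thesis
    using W_ge_2[OF i(1)] n by (simp add: lucky_lk)
qed

section \<open>Enclosures on a grid\<close>

text \<open>\<open>Row v g y u N s l h a b\<close> records the bounds \<open>y \<le> lk v \<le> u\<close>, \<open>y + i s \<le> lk (v + i)\<close> for
  all \<open>i\<close>, and \<open>l \<le> 10^5 W v \<le> h\<close>. The gap to the row below it in the list, with index \<open>v'\<close>,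
  is \<open>g = v - v'\<close>, and \<open>N \<le> lk (Suc v') + 1\<close>. The bounds on \<open>lk v\<close> come from following the
  \<open>v\<close>-th lucky number back through the stages from row \<open>a\<close> down to row \<open>b\<close>.\<close>

datatype row = Row nat nat nat nat nat nat nat nat nat nat

text \<open>\<open>z\<close> and \<open>k\<close> are a lower and an upper bound for the position, counted from \<open>1\<close>; \<open>q\<close> and
  \<open>p\<close> bound the quotients by which it increases in all stages between two consecutive rows.
  They grow along the list, so searching them by increments replaces the divisions.\<close>

declare conj_cong [fundef_cong]

function (sequential) track :: "nat \<Rightarrow> row list \<Rightarrow> nat \<Rightarrow> nat \<Rightarrow> nat \<Rightarrow> nat \<Rightarrow> nat \<Rightarrow> nat \<Rightarrow> nat \<Rightarrow> bool" where
  "track t [] q z p k Y U S = False"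
| "track t (Row v g y u N s l h a b # rs) q z p k Y U S =
    (if v = t then S * 100000 \<le> l \<and> Y * 100000 + v * l \<le> z * l \<and> k * h \<le> U * 100000 + h
     else if (q + 1) * u < z then q < z \<and> track t (Row v g y u N s l h a b # rs) (q + 1) z p k Y U S
     else if k + p * g < (p + 1) * N then track t rs q (z + q * g) p (k + p * g) Y U S
     else p < k \<and> track t (Row v g y u N s l h a b # rs) q z (p + 1) k Y U S)"

  by pat_completeness auto
text \<open>Because of \<open>conj_cong\<close> the guards \<open>q < z\<close> and
  \<open>p < k\<close> are available here: a search step lowers \<open>z - q\<close> or
  \<open>k - p\<close> and keeps the list, the remaining call shortens the list.\<close>

termination
  by (relation "measures [\<lambda>(t, rs, q, z, p, k, Y, U, S). length rs,
      \<lambda>(t, rs, q, z, p, k, Y, U, S). z - q, \<lambda>(t, rs, q, z, p, k, Y, U, S). k - p]") auto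

declare track.simps(2) [simp del]

text \<open>The test \<open>n <= y + 1\<close> ensures that the stages after row \<open>e\<close>
  leave position \<open>n - 1\<close> where it is, so the track may start at \<open>e\<close>. It
  ends at row \<open>t\<close>, below which the enclosure of \<open>W t\<close> replaces the
  stages.\<close>

fun locate :: "nat \<Rightarrow> nat \<Rightarrow> row list \<Rightarrow> nat \<Rightarrow> nat \<Rightarrow> nat \<Rightarrow> nat \<Rightarrow> bool" where
  "locate e t [] n Y U S = False"
| "locate e t (Row v g y u N s l h a b # rs) n Y U S =
    (if v = e then n \<le> y + 1 \<and> track t (Row v g y u N s l h a b # rs) 0 n 0 n Y U S
     else locate e t rs n Y U S)"

text \<open>All conditions are cleared of denominators and subtractions, so that they can be
  evaluated on numerals. For \<open>g > 1\<close> the upper bound \<open>h\<close> comes from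
  \<open>W_add_le\<close> with \<open>A = y'\<close> and \<open>B = s'\<close>: the condition on
  \<open>h\<close> is \<open>h' * Q <= h * (Q - M)\<close>. The condition on \<open>l\<close> is
  \<open>W_add_ge\<close>.\<close>

fun step_ok :: "row \<Rightarrow> row list \<Rightarrow> bool" where
  "step_ok (Row v g y u N s l h a b) [] =
    (v = 1 \<and> y = 1 \<and> u = 1 \<and> s = 1 \<and> l = 200000 \<and> h = 200000)"
| "step_ok (Row v g y u N s l h a b) (Row v' g' y' u' N' s' l' h' a' b' # rs) =
    (v = v' + g \<and> 0 < g \<and> 0 < y \<and> 0 < y' \<and> u' \<le> u \<and>
     (if g = 1 then N \<le> y + 1 \<and> h' * (y + 1) \<le> h * y
      else N \<le> y' + 2 \<and> g * (2 * y' + g * s') < 2 * y' * (y' + g * s') \<and>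
        h' * (2 * y' * (y' + g * s')) + h * (g * (2 * y' + g * s')) \<le>
        h * (2 * y' * (y' + g * s')) + h * (g * s')) \<and>
     l * u \<le> l' * (u + g) \<and>
     locate a b (Row v' g' y' u' N' s' l' h' a' b' # rs) v y u s)"

fun valid :: "row list \<Rightarrow> bool" where
  "valid [] = True"
| "valid (r # rs) = (step_ok r rs \<and> valid rs)"

fun row_ok :: "row \<Rightarrow> bool" where
  "row_ok (Row v g y u N s l h a b) \<longleftrightarrow>
    1 \<le> v \<and> y \<le> lk v \<and> lk v \<le> u \<and> (\<forall>i. y + i * s \<le> lk (v + i)) \<and>
    real l \<le> 100000 * W v \<and> 100000 * W v \<le> real h"

fun rows_ok :: "row list \<Rightarrow> bool" where
  "rows_ok [] = False"
| "rows_ok [r] = row_ok r"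
| "rows_ok (Row v g y u N s l h a b # Row v' g' y' u' N' s' l' h' a' b' # rs) =
    (v = v' + g \<and> 0 < g \<and> u' \<le> u \<and> N \<le> lk (Suc v') + 1 \<and> row_ok (Row v g y u N s l h a b) \<and>
     rows_ok (Row v' g' y' u' N' s' l' h' a' b' # rs))"

lemma rows_ok_hd: "rows_ok (r # rs) \<Longrightarrow> row_ok r"
  by (cases rs; cases r; cases "hd rs") auto

text \<open>\<open>u\<close> bounds every divisor in the block and \<open>q * u < z\<close> means
  \<open>q <= (z - 1) div u\<close>. One \<open>q\<close> serves all shifts \<open>i\<close>, since
  a larger position has no smaller quotient.\<close>

lemma pos_step_ge:
  assumes "1 \<le> v'" "v = v' + g" "lk v \<le> u" "1 \<le> u" "q * u < z"
  shows "pos 0 v' (z + q * g - 1 + i) \<le> pos 0 v (z - 1 + i)"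
proof -
  have "q * u \<le> z - 1 + i" using assms by simp
  then have q: "q \<le> (z - 1 + i) div u" using assms by (simp add: less_eq_div_iff_mult_less_eq)
  have "z + q * g - 1 + i = (z - 1 + i) + q * g" using assms(5) by simp
  also have "\<dots> \<le> (z - 1 + i) + (z - 1 + i) div u * g"
    by (intro add_left_mono mult_le_mono1 q)
  also have "\<dots> \<le> pos v' v (z - 1 + i)"
    using pos_ge_block[of v' v u "z - 1 + i"] assms lk_mono[of _ v]
    by (metis add_diff_cancel_left' dual_order.trans le_trans less_imp_le)
  finally have "pos 0 v' (z + q * g - 1 + i) \<le> pos 0 v' (pos v' v (z - 1 + i))"
    by (rule pos_mono)
  also have "\<dots> = pos 0 v (z - 1 + i)" using assms by (intro pos_pos) auto
  finally show ?thesis .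
qed

lemma pos_step_le:
  assumes "v = v' + g" "0 < g" "N \<le> lk (Suc v') + 1" "1 \<le> k" "k + p * g < (p + 1) * N"
  shows "pos 0 v (k - 1) \<le> pos 0 v' (k + p * g - 1)"
proof -
  obtain j where j: "g = Suc j" using assms(2) gr0_conv_Suc by blast
  have "k + p * g < (p + 1) * (lk (Suc v') + 1)"
    using assms(3,5) mult_le_mono2 order_less_le_trans by blast
  \<comment> \<open>\<open>N\<close> bounds a lucky number, one more than the divisor; the surplus
    \<open>p + 1\<close> on the right pays exactly for passing from \<open>k\<close> to
    \<open>k - 1\<close> and from \<open>g\<close> to \<open>g - 1\<close>.\<close>
  then have "(k - 1) + p * (v - v' - 1) < (p + 1) * lk (Suc v')"
    using assms(1,4) by (simp add: j algebra_simps)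
  then have "pos v' v (k - 1) \<le> (k - 1) + p * (v - v')"
    using assms(1,2) by (intro pos_le_block) (auto intro: lk_mono simp del: mult_Suc)
  then have "pos v' v (k - 1) \<le> k + p * g - 1"
    using assms(1,4) by simp
  then have "pos 0 v' (pos v' v (k - 1)) \<le> pos 0 v' (k + p * g - 1)"
    by (rule pos_mono)
  then show ?thesis using assms by (simp add: pos_pos)
qed

fun row_v :: "row \<Rightarrow> nat" where
  "row_v (Row v g y u N s l h a b) = v"

fun row_u :: "row \<Rightarrow> nat" where
  "row_u (Row v g y u N s l h a b) = u"

text \<open>\<open>L\<close> and \<open>X\<close> stay abstract, so the invariant only says that the
  current positions bound them. The slope arises at the target row: by \<open>W_le_pos\<close> every
  further position is worth \<open>W t\<close>, which is at least \<open>S\<close>.\<close>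

lemma track_sound:
  assumes "track t rs q z p k Y U S" "rows_ok rs" "1 \<le> k"
    and "q * row_u (hd rs) < z" "row_v (hd rs) \<le> z"
    and "\<And>i. pos 0 (row_v (hd rs)) (z - 1 + i) \<le> L i" "X \<le> pos 0 (row_v (hd rs)) (k - 1)"
  shows "Y + i * S \<le> L i \<and> X \<le> U"
  using assms
proof (induction t rs q z p k Y U S rule: track.induct)
  case (2 t v g y u N s l h a b rs q z p k Y U S)
  have ok: "row_ok (Row v g y u N s l h a b)" using "2.prems"(2) by (rule rows_ok_hd)
  have bn: "if v = t then S * 100000 \<le> l \<and> Y * 100000 + v * l \<le> z * l \<and> k * h \<le> U * 100000 + h
     else if (q + 1) * u < z then q < z \<and> track t (Row v g y u N s l h a b # rs) (q + 1) z p k Y U S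
     else if k + p * g < (p + 1) * N then track t rs q (z + q * g) p (k + p * g) Y U S
     else p < k \<and> track t (Row v g y u N s l h a b # rs) q z (p + 1) k Y U S"
    using "2.prems"(1) by (subst (asm) track.simps(2))
  have qz: "q * u < z" and vz: "v \<le> z" and k1: "1 \<le> k" using "2.prems" by auto
  have L: "pos 0 v (z - 1 + i) \<le> L i" for i using "2.prems"(6) by simp
  have X: "X \<le> pos 0 v (k - 1)" using "2.prems"(7) by simp
  consider "v = t" | "v \<noteq> t" "(q + 1) * u < z" | "v \<noteq> t" "\<not> (q + 1) * u < z" "k + p * g < (p + 1) * N"
    | "v \<noteq> t" "\<not> (q + 1) * u < z" "\<not> k + p * g < (p + 1) * N" by blast
  then show ?case
  proof cases
    case 1
    then have b: "S * 100000 \<le> l" "Y * 100000 + v * l \<le> z * l" "k * h \<le> U * 100000 + h"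
      using bn by simp_all
    have lW: "real l \<le> 100000 * W v" and hW: "100000 * W v \<le> real h" using ok by auto
    have v1: "1 \<le> v" using ok by simp
    have "real (Y * 100000 + v * l) \<le> real (z * l)" using b(2) by (rule of_nat_mono)
    then have Y: "real Y * 100000 \<le> (real z - real v) * l" by (simp add: algebra_simps)
    have "real (S * 100000) \<le> real l" using b(1) by (rule of_nat_mono)
    then have "real i * (real S * 100000) \<le> real i * l" by (intro mult_left_mono) auto
    then have "(real Y + real i * real S) * 100000 \<le> (real z - real v + real i) * l"
      using Y by (simp add: algebra_simps)
    also have "\<dots> \<le> (real z - real v + real i) * (100000 * W v)"
      using vz by (intro mult_left_mono lW) auto
    finally have "real Y + real i * real S \<le> (real (z - 1 + i) + 1 - real v) * W v"
      using vz v1 by (simp add: of_nat_diff algebra_simps)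
    also have "\<dots> \<le> real (pos 0 v (z - 1 + i))" by (rule W_le_pos[OF v1])
    also have "\<dots> \<le> real (L i)" using L by simp
    finally have low: "real (Y + i * S) \<le> real (L i)" by simp
    have "real X \<le> real (pos 0 v (k - 1))" using X by simp
    then have "real X \<le> real (k - 1) * W v" using pos_le_W order_trans by blast
    then have "real X * 100000 \<le> real (k - 1) * (100000 * W v)" by simp
    also have "\<dots> \<le> real (k - 1) * real h" by (intro mult_left_mono hW) auto
    also have "\<dots> = real (k * h) - real h"
      using k1 by (simp add: of_nat_diff algebra_simps)
    also have "\<dots> \<le> real (U * 100000)" using of_nat_mono[OF b(3), where 'a = real] by simp
    finally have "real X \<le> real U" by simp
    with low show ?thesis by (simp only: of_nat_le_iff)
  next
    case 2
    then have "q < z" "track t (Row v g y u N s l h a b # rs) (q + 1) z p k Y U S"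
      using bn by simp_all
    then show ?thesis
      by (rule "2.IH"(1)[OF 2 _ _ "2.prems"(2,3)]) (use 2 vz L X in simp_all)
  next
    case 3
    then have bn': "track t rs q (z + q * g) p (k + p * g) Y U S" using bn by simp
    from bn' obtain v' g' y' u' N' s' l' h' a' b' rs'' where
      rs: "rs = Row v' g' y' u' N' s' l' h' a' b' # rs''"
      by (cases rs; cases "hd rs") auto
    have lnk: "v = v' + g" "0 < g" "u' \<le> u" "N \<le> lk (Suc v') + 1" "rows_ok rs"
      using "2.prems"(2) by (auto simp: rs)
    have v1: "1 \<le> v'" using rows_ok_hd[OF lnk(5)[unfolded rs]] by simp
    have "q * u' \<le> q * u" using lnk(3) by simp
    then have qz': "q * u' < z + q * g" using qz by linarith
    have u1: "lk v \<le> u" "1 \<le> u" using ok lk_ge[of v] by auto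
    have L': "pos 0 v' (z + q * g - 1 + i) \<le> L i" for i
      using pos_step_ge[OF v1 lnk(1) u1, of q z i] qz L[of i] by auto
    have X': "X \<le> pos 0 v' (k + p * g - 1)"
      using pos_step_le[OF lnk(1,2,4) k1 3(3)] X by auto
    show ?thesis
      by (rule "2.IH"(2)[OF 3 bn' lnk(5)]) (use k1 vz lnk qz' L' X' in \<open>simp_all add: rs\<close>)
  next
    case 4
    then have "p < k" "track t (Row v g y u N s l h a b # rs) q z (p + 1) k Y U S"
      using bn by simp_all
    then show ?thesis
      by (rule "2.IH"(3)[OF 4 _ _ "2.prems"(2,3)]) (use qz vz L X in simp_all)
  qed
qed simp

lemma locate_sound:
  assumes "locate e t rs n Y U S" "rows_ok rs" "row_v (hd rs) < n"
  shows "Y + i * S \<le> lk (n + i) \<and> lk n \<le> U"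
  using assms
proof (induction e t rs n Y U S rule: locate.induct)
  case (2 e t v g y u N s l h a b rs n Y U S)
  have ok: "row_ok (Row v g y u N s l h a b)" using "2.prems"(2) by (rule rows_ok_hd)
  show ?case
  proof (cases "v = e")
    case True
    then have n: "n \<le> y + 1" and bn: "track t (Row v g y u N s l h a b # rs) 0 n 0 n Y U S"
      using "2.prems"(1) by auto
    have vn: "v \<le> n - 1" "1 \<le> v" "2 \<le> n" using "2.prems"(3) ok by auto
    have L: "pos 0 v (n - 1 + i) \<le> lk (n + i)" for i
      using lk_ge_pos[of v "n - 1 + i"] vn by simp
    have "pos v (n - 1) (n - 1) = n - 1"
    proof (rule pos_eq_block)
      fix m assume "v < m" "m \<le> n - 1"
      then have "lk v < lk m" using vn by (intro lk_less) auto
      then show "n - 1 < lk m" using ok n by auto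
    qed
    then have "lk n = pos 0 v (n - 1)"
      using vn by (metis lk_pos pos_pos le0)
    then show ?thesis
      using track_sound[OF bn "2.prems"(2), where L = "\<lambda>i. lk (n + i)" and X = "lk n"] L vn by simp
  next
    case False
    then have bn: "locate e t rs n Y U S" using "2.prems"(1) by simp
    then obtain v' g' y' u' N' s' l' h' a' b' rs'' where
      rs: "rs = Row v' g' y' u' N' s' l' h' a' b' # rs''"
      by (cases rs; cases "hd rs") auto
    show ?thesis
      using "2.IH"[OF False bn] "2.prems"(2,3) by (simp add: rs)
  qed
qed simp

text \<open>An upper bound \<open>1 / (1 - sum)\<close> for the product that stays rational, in
  place of the exponential of the sum.\<close>

lemma prod_one_plus_le:
  fixes x :: "nat \<Rightarrow> real"
  assumes "\<And>i. 0 \<le> x i"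
  shows "(\<Prod>i<n. 1 + x i) * (1 - (\<Sum>i<n. x i)) \<le> 1"
proof (induction n)
  case (Suc n)
  let ?P = "\<Prod>i<n. 1 + x i" and ?S = "\<Sum>i<n. x i"
  have P: "0 \<le> ?P" using assms by (intro prod_nonneg) (simp add: add_nonneg_nonneg)
  have S: "0 \<le> ?S" using assms by (intro sum_nonneg) auto
  have "(1 + x n) * (1 - (?S + x n)) = (1 - ?S) - x n * (?S + x n)"
    by (simp add: algebra_simps)
  also have "\<dots> \<le> 1 - ?S" using assms[of n] S by simp
  finally have "?P * ((1 + x n) * (1 - (?S + x n))) \<le> ?P * (1 - ?S)"
    using P by (rule mult_left_mono)
  then show ?case using Suc by (simp add: mult.assoc)
qed simp

lemma one_plus_sum_le_prod:
  fixes x :: "nat \<Rightarrow> real"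
  assumes "\<And>i. 0 \<le> x i"
  shows "1 + (\<Sum>i<n. x i) \<le> (\<Prod>i<n. 1 + x i)"
proof (induction n)
  case (Suc n)
  have "0 \<le> (\<Sum>i<n. x i) * x n" using assms by (intro mult_nonneg_nonneg sum_nonneg) auto
  then have "1 + (\<Sum>i<Suc n. x i) \<le> (1 + (\<Sum>i<n. x i)) * (1 + x n)"
    by (simp add: algebra_simps)
  also have "\<dots> \<le> (\<Prod>i<n. 1 + x i) * (1 + x n)"
    using Suc assms[of n] by (intro mult_right_mono) auto
  finally show ?case by simp
qed simp

lemma W_add: "W (a + g) = W a * (\<Prod>i<g. 1 + 1 / lk (a + Suc i))"
  by (induction g) (simp_all add: W_Suc mult_ac)

text \<open>The sum of the convex function \<open>1 / (A + i B)\<close> is bounded by its secant on \<open>[0, g]\<close>.\<close>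

lemma W_add_le:
  fixes A B :: real
  assumes A: "0 < A" and B: "0 \<le> B"
    and lk: "\<And>i. 1 \<le> i \<Longrightarrow> i \<le> g \<Longrightarrow> A + i * B \<le> lk (a + i)"
  defines "Q \<equiv> 2 * A * (A + g * B)" and "M \<equiv> g * (2 * A + g * B) - g * B"
  assumes MQ: "M < Q"
  shows "W (a + g) * (Q - M) \<le> W a * Q"
proof -
  define x where "x i = 1 / real (lk (a + Suc i))" for i
  have gB: "0 < A + g * B" using A B by (simp add: add_pos_nonneg)
  have Q: "0 < Q" unfolding Q_def using A gB by simp
  have x: "x i \<le> 1 / A - real (Suc i) * (B / (A * (A + g * B)))" if "i < g" for i
  proof -
    let ?i = "real (Suc i)"
    have iB: "0 < A + ?i * B" using A B by (intro add_pos_nonneg mult_nonneg_nonneg) auto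
    have le: "A + ?i * B \<le> A + g * B" using that B by (intro add_left_mono mult_right_mono) auto
    have "x i \<le> 1 / (A + ?i * B)"
      unfolding x_def using lk[of "Suc i"] that iB by (intro divide_left_mono) auto
    also have "\<dots> = 1 / A - ?i * B / (A * (A + ?i * B))"
      using A iB by (simp add: divide_simps)
    also have "\<dots> \<le> 1 / A - ?i * B / (A * (A + g * B))"
    proof -
      have "?i * B / (A * (A + g * B)) \<le> ?i * B / (A * (A + ?i * B))"
        using A B iB gB le by (intro divide_left_mono mult_left_mono mult_pos_pos) auto
      then show ?thesis by simp
    qed
    finally show ?thesis by simp
  qed
  have gauss: "(\<Sum>i<n. real (Suc i)) = real n * (real n + 1) / 2" for n
    by (induction n) (simp_all add: field_simps)
  have "(\<Sum>i<g. x i) \<le> (\<Sum>i<g. 1 / A - real (Suc i) * (B / (A * (A + g * B))))"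
    by (intro sum_mono x) auto
  also have "\<dots> = g / A - real g * (real g + 1) / 2 * (B / (A * (A + g * B)))"
    by (simp only: sum_subtractf sum_distrib_right[symmetric] gauss) simp
  also have "\<dots> = M / Q"
    using A gB by (simp add: M_def Q_def divide_simps) (simp add: algebra_simps)
  finally have S: "1 - M / Q \<le> 1 - (\<Sum>i<g. x i)" by simp
  have P: "0 \<le> (\<Prod>i<g. 1 + x i)" by (intro prod_nonneg) (simp add: x_def)
  have "(\<Prod>i<g. 1 + x i) * (1 - M / Q) \<le> (\<Prod>i<g. 1 + x i) * (1 - (\<Sum>i<g. x i))"
    by (intro mult_left_mono S P)
  also have "\<dots> \<le> 1" by (intro prod_one_plus_le) (simp add: x_def)
  finally have "(\<Prod>i<g. 1 + x i) * (Q - M) \<le> Q"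
    using Q by (simp add: field_simps)
  then have "W a * ((\<Prod>i<g. 1 + x i) * (Q - M)) \<le> W a * Q"
    by (intro mult_left_mono less_imp_le[OF W_pos])
  then show ?thesis by (simp add: W_add x_def mult.assoc)
qed

lemma W_add_ge: "W a * (1 + g / lk (a + g)) \<le> W (a + g)"
proof -
  have "real g / lk (a + g) = (\<Sum>i<g. 1 / real (lk (a + g)))" by simp
  also have "\<dots> \<le> (\<Sum>i<g. 1 / real (lk (a + Suc i)))"
  proof (intro sum_mono)
    fix i assume "i \<in> {..<g}"
    then have "lk (a + Suc i) \<le> lk (a + g)" by (intro lk_mono) auto
    moreover have "0 < lk (a + Suc i)" using lk_ge[of "a + Suc i"] by simp
    ultimately show "1 / real (lk (a + g)) \<le> 1 / real (lk (a + Suc i))"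
      by (intro divide_left_mono) auto
  qed
  finally have "1 + g / lk (a + g) \<le> (\<Prod>i<g. 1 + 1 / real (lk (a + Suc i)))"
    using one_plus_sum_le_prod[of "\<lambda>i. 1 / real (lk (a + Suc i))" g] by simp
  then show ?thesis
    unfolding W_add by (intro mult_left_mono less_imp_le[OF W_pos]) auto
qed

text \<open>The order avoids circularity: lower rows give \<open>y\<close>, \<open>u\<close> and
  \<open>s\<close>; only then do \<open>l\<close> and \<open>h\<close> follow, \<open>l\<close> from
  \<open>u\<close>, and \<open>h\<close> from \<open>y\<close> if the gap is 1 and otherwise from
  the line with slope \<open>s'\<close> through the previous row.\<close>

lemma valid_sound: "valid rs \<Longrightarrow> rs \<noteq> [] \<Longrightarrow> rows_ok rs"
proof (induction rs)
  case (Cons r rs)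
  show ?case
  proof (cases rs)
    case Nil
    then show ?thesis using Cons.prems lk_add_le[of 1] by (cases r) (auto simp: lk_1 W_1)
  next
    case rs: (Cons r' rs')
    obtain v g y u N s l h a b where r: "r = Row v g y u N s l h a b" by (cases r)
    obtain v' g' y' u' N' s' l' h' a' b' where r': "r' = Row v' g' y' u' N' s' l' h' a' b'"
      by (cases r')
    let ?rs = "Row v' g' y' u' N' s' l' h' a' b' # rs'"
    have rs: "rs = ?rs" by (simp add: rs r')
    have pr0: "step_ok (Row v g y u N s l h a b) ?rs"
      using Cons.prems(1) unfolding rs r valid.simps by (rule conjunct1)
    have ok: "rows_ok ?rs" using Cons.IH Cons.prems(1) by (simp only: valid.simps rs) simp
    note pr = pr0[unfolded step_ok.simps]
    have v: "v = v' + g" "0 < g" "u' \<le> u" "0 < y" "0 < y'" and lu: "l * u \<le> l' * (u + g)"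
      using pr by blast+
    have ok': "1 \<le> v'" "y' \<le> lk v'" "\<And>i. y' + i * s' \<le> lk (v' + i)"
      "real l' \<le> 100000 * W v'" "100000 * W v' \<le> real h'"
      using rows_ok_hd[OF ok] by auto
    have bn: "locate a b ?rs v y u s" using pr by blast
    have bs: "y + i * s \<le> lk (v + i)" "lk v \<le> u" for i
      using locate_sound[OF bn ok] v by auto
    have y: "y \<le> lk v" using bs(1)[of 0] by simp
    have lk0: "0 < lk v" using y v by simp
    have N: "N \<le> lk (Suc v') + 1"
    proof (cases "g = 1")
      case True
      then show ?thesis using pr v y by simp
    next
      case False
      then show ?thesis using pr lk_less_Suc[OF ok'(1)] ok'(2) by simp
    qed
    have hi: "100000 * W v \<le> real h"
    proof (cases "g = 1")
      case True
      have "100000 * W v = 100000 * W v' * (1 + 1 / lk v)" using True v by (simp add: W_Suc)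
      also have "\<dots> \<le> real h' * (1 + 1 / y)"
        using y v ok' W_pos[of v'] by (intro mult_mono add_left_mono divide_left_mono) auto
      also have "\<dots> = real (h' * (y + 1)) / y" using v by (simp add: field_simps)
      also have "\<dots> \<le> real (h * y) / y"
        using True pr by (intro divide_right_mono of_nat_mono) auto
      finally show ?thesis using v by simp
    next
      case False
      define Q where "Q = 2 * real y' * (real y' + g * real s')"
      define M where "M = real g * (2 * real y' + g * real s') - g * real s'"
      have "real (g * (2 * y' + g * s')) < real (2 * y' * (y' + g * s'))"
        using False pr by (intro of_nat_less_iff[THEN iffD2]) auto
      then have "real g * (2 * real y' + g * real s') < Q" by (simp add: Q_def)
      moreover have "0 \<le> real g * real s'" by simp
      ultimately have MQ: "M < Q" unfolding M_def by linarith
      have "real (h' * (2 * y' * (y' + g * s')) + h * (g * (2 * y' + g * s')))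
          \<le> real (h * (2 * y' * (y' + g * s')) + h * (g * s'))"
        using False pr by (intro of_nat_mono) auto
      then have c: "real h' * Q \<le> real h * (Q - M)"
        by (simp add: M_def Q_def algebra_simps)
      have "real y' + real i * real s' \<le> real (lk (v' + i))" for i
        using of_nat_mono[OF ok'(3)[of i], where 'a = real] by simp
      then have "W v * (Q - M) \<le> W v' * Q"
        unfolding v(1) Q_def M_def using v MQ by (intro W_add_le) (auto simp: M_def Q_def)
      then have "100000 * W v * (Q - M) \<le> 100000 * W v' * Q" by simp
      also have "\<dots> \<le> real h' * Q"
        using ok' by (intro mult_right_mono) (auto simp: Q_def)
      finally have "100000 * W v * (Q - M) \<le> real h * (Q - M)" using c by linarith
      then show ?thesis using MQ by simp
    qed
    have lo: "real l \<le> 100000 * W v"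
    proof -
      have "real (l * u) \<le> real (l' * (u + g))" using lu by (rule of_nat_mono)
      then have "real l \<le> real l' * (1 + g / u)"
        using bs(2) lk0 by (simp add: field_simps)
      also have "\<dots> \<le> 100000 * W v' * (1 + g / lk v)"
        using bs(2) lk0 ok' W_pos[of v'] by (intro mult_mono add_left_mono divide_left_mono) auto
      also have "\<dots> \<le> 100000 * W v" using W_add_ge[of v' g] v by simp
      finally show ?thesis .
    qed
    show ?thesis unfolding r rs using ok v N bs hi lo y ok' by simp
  qed
qed simp

section \<open>Comparison with logarithms on the grid\<close>

definition bound1 :: "real \<Rightarrow> real" where
  "bound1 x = ln x + 1 / 2 * (ln (ln x))\<^sup>2 + 1"

text \<open>The first two terms of the series of \<open>2 * artanh t\<close>. With
  \<open>t = d / (2 * m + d)\<close> the difference of logarithms is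
  \<open>ln (m + d) - ln m\<close>.\<close>

lemma ln_ratio_ge:
  fixes t :: real
  assumes "0 \<le> t" "t < 1"
  shows "2 * t + 2 / 3 * t ^ 3 \<le> ln (1 + t) - ln (1 - t)"
proof -
  define f where "f x = ln (1 + x) - ln (1 - x) - 2 * x - 2 / 3 * x ^ 3" for x :: real
  have "f 0 \<le> f t"
  proof (rule DERIV_nonneg_imp_nondecreasing[OF assms(1)])
    fix x assume x: "0 \<le> x" "x \<le> t"
    then have x1: "x < 1" "x * x < 1"
      using assms(2) mult_strict_mono[of x 1 x 1] by auto
    have "(f has_real_derivative 2 * x ^ 4 / (1 - x\<^sup>2)) (at x)"
      unfolding f_def using x x1
      by (auto intro!: derivative_eq_intros simp: divide_simps) (simp_all add: algebra_simps power2_eq_square power4_eq_xxxx)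
    then show "\<exists>y. (f has_real_derivative y) (at x) \<and> 0 \<le> y"
      using x x1 by (intro exI[of _ "2 * x ^ 4 / (1 - x\<^sup>2)"]) (auto simp: power2_eq_square)
  qed
  then show ?thesis by (simp add: f_def)
qed

lemma ln_add_ge3:
  fixes m d :: real
  assumes "0 < m" "0 \<le> d"
  shows "ln m + 2 * (d / (2 * m + d)) + 2 / 3 * (d / (2 * m + d)) ^ 3 \<le> ln (m + d)"
proof -
  let ?t = "d / (2 * m + d)"
  have t: "0 \<le> ?t" "?t < 1" using assms by auto
  then have pos: "1 + ?t \<noteq> 0" "1 - ?t > 0" by linarith+
  have "1 + ?t = 2 * (m + d) / (2 * m + d)" "1 - ?t = 2 * m / (2 * m + d)"
    using assms by (simp_all add: field_simps)
  then have "(1 + ?t) / (1 - ?t) = (2 * (m + d)) / (2 * m)" using assms by simp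
  then have "(1 + ?t) / (1 - ?t) = (m + d) / m" by (simp only: mult_divide_mult_cancel_left_if) simp
  then have "ln (1 + ?t) - ln (1 - ?t) = ln (m + d) - ln m"
    using t pos assms ln_div[of "1 + ?t" "1 - ?t"] ln_div[of "m + d" m] by simp
  then show ?thesis using ln_ratio_ge[OF t] by simp
qed

lemma ln_add_ge:
  fixes m d :: real
  assumes "0 < m" "0 \<le> d"
  shows "ln m + 2 * d / (2 * m + d) \<le> ln (m + d)"
proof -
  have "0 \<le> 2 / 3 * (d / (2 * m + d)) ^ 3" using assms by simp
  then show ?thesis using ln_add_ge3[OF assms] by linarith
qed

lemma ln_2_ge: "0.69299 \<le> ln (2 :: real)"
proof -
  \<comment> \<open>Splitting 2 as 4/3 times 3/2 lowers the series argument from 1/3 to 1/7 and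
    1/5.\<close>
  have "ln (2::real) = ln (1 + 1/3) + ln (1 + 1/2)"
    by (subst ln_mult_pos[symmetric]) auto
  then show ?thesis
    using ln_add_ge3[of 1 "1/3"] ln_add_ge3[of 1 "1/2"] by (simp add: power3_eq_cube)
qed

text \<open>Lower bounds for \<open>ln m\<close> and \<open>ln (ln m)\<close> in units of
  \<open>10^-6\<close>. \<open>C\<close> refers to the rational \<open>A / 1000000\<close> instead
  of \<open>ln m\<close>, so that it can be updated from the pair \<open>A\<close>,
  \<open>A'\<close> alone.\<close>

definition log_inv :: "nat \<Rightarrow> nat \<Rightarrow> nat \<Rightarrow> bool" where
  "log_inv m A C \<longleftrightarrow> 1 \<le> m \<and> 1000000 < A \<and> A / 1000000 \<le> ln (real m) \<and> C / 1000000 \<le> ln (A / 1000000)"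

lemma log_inv_bound1:
  assumes "log_inv m A C" "real m \<le> x"
  shows "2000000 * real A + real C * real C + 2000000000000 \<le> 2000000000000 * bound1 x"
proof -
  let ?A = "real A / 1000000" and ?C = "real C / 1000000"
  have m: "1 \<le> real m" "1 < ?A" "?A \<le> ln m" "?C \<le> ln ?A" using assms by (auto simp: log_inv_def)
  have "ln (real m) \<le> ln x" using m assms(2) by simp
  then have A: "?A \<le> ln x" using m by linarith
  then have "ln ?A \<le> ln (ln x)" using m by simp
  then have "?C \<le> ln (ln x)" using m by linarith
  then have "?C\<^sup>2 \<le> (ln (ln x))\<^sup>2" by (intro power_mono) auto
  then have "?A + 1 / 2 * ?C\<^sup>2 + 1 \<le> bound1 x" using A by (simp add: bound1_def)
  then show ?thesis by (simp add: power2_eq_square field_simps)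
qed

text \<open>The condition on \<open>C'\<close> is
  \<open>C' <= C + 2000000 * (A' - A) / (A' + A)\<close>, which is \<open>ln_add_ge\<close> from
  \<open>A\<close> to \<open>A'\<close>, cleared of denominators.\<close>

lemma log_inv_step:
  assumes "log_inv m A C" "m \<le> m'" and A': "A \<le> A'" "A' / 1000000 \<le> ln (real m')"
    and C': "C' * (A' + A) + 2000000 * A \<le> C * (A' + A) + 2000000 * A'"
  shows "log_inv m' A' C'"
proof -
  have m: "1 \<le> m" "1000000 < A" "C / 1000000 \<le> ln (A / 1000000)" using assms by (auto simp: log_inv_def)
  let ?q = "2 * (real A' / 1000000 - real A / 1000000) /
      (2 * (real A / 1000000) + (real A' / 1000000 - real A / 1000000))"
  have "real (C' * (A' + A) + 2000000 * A) \<le> real (C * (A' + A) + 2000000 * A')"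
    using C' by (rule of_nat_mono)
  then have "real C' * (real A' + real A) \<le> real C * (real A' + real A) + 2000000 * (real A' - real A)"
    by simp
  then have "real C' \<le> real C + 2000000 * (real A' - real A) / (real A' + real A)"
    using m(2) by (simp add: field_simps)
  then have "real C' / 1000000 \<le> real C / 1000000 + 2 * (real A' - real A) / (real A' + real A)"
    by simp
  also have "2 * (real A' - real A) / (real A' + real A) = ?q"
    using m by (simp add: field_simps)
  finally have "real C' / 1000000 \<le> ln (real A / 1000000) + ?q" using m(3) by linarith
  also have "\<dots> \<le> ln (real A / 1000000 + (real A' / 1000000 - real A / 1000000))"
    using m A' by (intro ln_add_ge) (auto simp: divide_right_mono)
  finally show ?thesis using assms m by (simp add: log_inv_def)
qed

lemma log_inv_4: "log_inv 4 1385980 326300"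
proof -
  have l4: "ln (4::real) = 2 * ln 2" using ln_realpow[of 2 2] by simp
  have "ln (1385980 / 1000000 :: real) \<ge> 0.3263"
    using ln_add_ge3[of 1 "385980 / 1000000"] by (simp add: power3_eq_cube)
  then show ?thesis unfolding log_inv_def using ln_2_ge l4 by simp
qed

text \<open>63 is the 15th lucky number, where the comparison by blocks starts; its logarithm is
  reached from \<open>ln 64 = 6 * ln 2\<close>.\<close>

lemma log_inv_63: "log_inv 63 4142000 1420800"
proof -
  have "ln (64::real) = 6 * ln 2" using ln_realpow[of 2 6] by simp
  moreover have "ln (64 / 63 :: real) \<le> 1 / 63" using ln_le_minus_one[of "64 / 63 :: real"] by simp
  moreover have "ln (64 / 63 :: real) = ln 64 - ln 63" by (subst ln_div) auto
  moreover have "ln (4::real) = 2 * ln 2" using ln_realpow[of 2 2] by simp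
  moreover have "ln (4::real) + 2 * 0.142 / (2 * 4 + 0.142) \<le> ln (4 + 0.142)" by (rule ln_add_ge) auto
  ultimately show ?thesis unfolding log_inv_def using ln_2_ge by simp
qed

section \<open>Tests that compare the rows with the first bound and with the growth rate\<close>

fun row_y :: "row \<Rightarrow> nat" where
  "row_y (Row v g y u N s l h a b) = y"

lemma rows_ok_set: "rows_ok rs \<Longrightarrow> r \<in> set rs \<Longrightarrow> row_ok r"
proof (induction rs rule: rows_ok.induct)
  case (3 v g y u N s l h a b v' g' y' u' N' s' l' h' a' b' rs)
  then show ?case by (auto simp del: row_ok.simps)
qed auto

lemma valid_row_ok: "valid rs \<Longrightarrow> r \<in> set rs \<Longrightarrow> row_ok r"
  by (rule rows_ok_set[OF valid_sound]) auto

text \<open>For \<open>v <= i < v'\<close> and \<open>lucky i <= n\<close> there holds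
  \<open>W i <= W v'\<close> and \<open>n >= y + 1\<close>. So the largest product of the block is
  compared with the bound at its smallest \<open>n\<close>; everything is scaled by
  \<open>2 * 10^12\<close>.\<close>

fun check_blocks :: "(nat \<times> nat) list \<Rightarrow> row list \<Rightarrow> bool" where
  "check_blocks [(A, C)] (Row v g y u N s l h a b # rs) =
    (v = 15 \<and> y = 62 \<and> A = 4142000 \<and> C = 1420800)"
| "check_blocks ((A', C') # (A, C) # cs) (Row v' g' y' u' N' s' l' h' a' b' # Row v g y u N s l h a b # rs) =
    (y \<le> y' \<and> A \<le> A' \<and>
     A' * (y' + y + 2) + 2000000 * y \<le> A * (y' + y + 2) + 2000000 * y' \<and>
     C' * (A' + A) + 2000000 * A \<le> C * (A' + A) + 2000000 * A' \<and>
     h' * 20000000 \<le> 2000000 * A + C * C + 2000000000000 \<and>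
     check_blocks ((A, C) # cs) (Row v g y u N s l h a b # rs))"
| "check_blocks cs rs = False"

lemma check_blocks_sound:
  assumes "check_blocks cs rs" "\<forall>r \<in> set rs. row_ok r"
  shows "log_inv (row_y (hd rs) + 1) (fst (hd cs)) (snd (hd cs)) \<and>
    (\<forall>i n. 15 \<le> i \<longrightarrow> i < row_v (hd rs) \<longrightarrow> lucky i \<le> n \<longrightarrow> W i \<le> bound1 (real n))"
  using assms
proof (induction cs rs rule: check_blocks.induct)
  case (1 A C v g y u N s l h a b rs)
  then show ?case using log_inv_63 by auto
next
  case (2 A' C' A C cs v' g' y' u' N' s' l' h' a' b' v g y u N s l h a b rs)
  have ok: "row_ok (Row v g y u N s l h a b)" "row_ok (Row v' g' y' u' N' s' l' h' a' b')"
    using "2.prems"(2) by auto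
  have c: "y \<le> y'" "A \<le> A'"
    "A' * (y' + y + 2) + 2000000 * y \<le> A * (y' + y + 2) + 2000000 * y'"
    "C' * (A' + A) + 2000000 * A \<le> C * (A' + A) + 2000000 * A'"
    "h' * 20000000 \<le> 2000000 * A + C * C + 2000000000000"
    "check_blocks ((A, C) # cs) (Row v g y u N s l h a b # rs)"
    using "2.prems"(1) by simp_all
  have IH: "log_inv (y + 1) A C"
    "15 \<le> i \<Longrightarrow> i < v \<Longrightarrow> lucky i \<le> n \<Longrightarrow> W i \<le> bound1 (real n)" for i n
    using "2.IH"[OF c] "2.prems"(2) by auto
  have "real (A' * (y' + y + 2) + 2000000 * y) \<le> real (A * (y' + y + 2) + 2000000 * y')"
    using c(3) by (rule of_nat_mono)
  then have "real A' * (real y' + real y + 2) \<le> real A * (real y' + real y + 2) + 2000000 * (real y' - real y)"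
    by (simp add: algebra_simps)
  then have "real A' \<le> real A + 2000000 * (real y' - real y) / (real y' + real y + 2)"
    by (simp add: field_simps)
  then have "real A' / 1000000 \<le> real A / 1000000 + 2 * (real y' - real y) / (real y' + real y + 2)"
    by simp
  moreover have "real A / 1000000 \<le> ln (real y + 1)" using IH(1) by (simp add: log_inv_def add.commute)
  moreover have "ln (real y + 1) + 2 * (real y' - real y) / (2 * (real y + 1) + (real y' - real y))
      \<le> ln (real y + 1 + (real y' - real y))"
    using c(1) by (intro ln_add_ge) auto
  moreover have "2 * (real y + 1) + (real y' - real y) = real y' + real y + 2"
    "real y + 1 + (real y' - real y) = real (y' + 1)" by simp_all
  ultimately have "real A' / 1000000 \<le> ln (real (y' + 1))" by (simp only:)
  then have log: "log_inv (y' + 1) A' C'"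
    using c by (intro log_inv_step[OF IH(1)]) auto
  have "W i \<le> bound1 (real n)" if i: "15 \<le> i" "i < v'" "lucky i \<le> n" for i n
  proof (cases "i < v")
    case False
    have "1 \<le> v" "y \<le> lk v" using ok by auto
    moreover have "lk v \<le> lk i" using False \<open>1 \<le> v\<close> by (intro lk_mono) auto
    ultimately have yn: "y + 1 \<le> n" using i by (simp add: lucky_lk)
    have "100000 * W i \<le> 100000 * W v'" using i by (simp add: W_mono)
    also have "\<dots> \<le> real h'" using ok by simp
    finally have "2000000000000 * W i \<le> real (h' * 20000000)" by simp
    also have "\<dots> \<le> real (2000000 * A + C * C + 2000000000000)" using c(5) by (rule of_nat_mono)
    also have "\<dots> \<le> 2000000000000 * bound1 (real n)"
      using log_inv_bound1[OF IH(1), of "real n"] yn by simp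
    finally show ?thesis by simp
  qed (use IH i in auto)
  then show ?case using log by auto
qed auto

text \<open>The inequality is very tight at \<open>n = 15\<close>: 63 against a right side below
  63.07. Therefore the steps from \<open>v\<close> to \<open>v + 1\<close> keep the cubic term of
  \<open>ln_add_ge3\<close>, here with \<open>t = 1 / (v' + v)\<close>.\<close>

fun check_small :: "(nat \<times> nat) list \<Rightarrow> row list \<Rightarrow> bool" where
  "check_small [(A, C)] (Row v g y u N s l h a b # rs) =
    (v = 4 \<and> A = 1385980 \<and> C = 326300 \<and>
     (u + 1) * 2000000000000 < v * (2000000 * A + C * C + 2000000000000))"
| "check_small ((A', C') # (A, C) # cs) (Row v' g' y' u' N' s' l' h' a' b' # Row v g y u N s l h a b # rs) =
    (v' = v + 1 \<and> A \<le> A' \<and>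
     3 * ((v' + v) * ((v' + v) * (v' + v))) * A' \<le>
       3 * ((v' + v) * ((v' + v) * (v' + v))) * A + 2000000 * (3 * ((v' + v) * (v' + v)) + 1) \<and>
     C' * (A' + A) + 2000000 * A \<le> C * (A' + A) + 2000000 * A' \<and>
     (u' + 1) * 2000000000000 < v' * (2000000 * A' + C' * C' + 2000000000000) \<and>
     check_small ((A, C) # cs) (Row v g y u N s l h a b # rs))"
| "check_small cs rs = False"

lemma lucky_less_bound1:
  assumes "log_inv m A C" "row_ok (Row m g y u N s l h a b)"
    and "(u + 1) * 2000000000000 < m * (2000000 * A + C * C + 2000000000000)"
  shows "real (lucky m) < real m * bound1 (real m)"
proof -
  have "lucky m \<le> u + 1" using assms(2) by (simp add: lucky_lk)
  then have "real (lucky m) * 2000000000000 \<le> real ((u + 1) * 2000000000000)"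
    by simp
  also have "\<dots> < real (m * (2000000 * A + C * C + 2000000000000))"
    using assms(3) by (rule of_nat_less_iff[THEN iffD2])
  also have "\<dots> = real m * (2000000 * real A + real C * real C + 2000000000000)" by simp
  also have "\<dots> \<le> real m * (2000000000000 * bound1 (real m))"
    by (intro mult_left_mono log_inv_bound1[OF assms(1)]) auto
  finally show ?thesis by simp
qed

lemma check_small_sound:
  assumes "check_small cs rs" "\<forall>r \<in> set rs. row_ok r"
  shows "log_inv (row_v (hd rs)) (fst (hd cs)) (snd (hd cs)) \<and>
    (\<forall>n. 4 \<le> n \<longrightarrow> n \<le> row_v (hd rs) \<longrightarrow> real (lucky n) < real n * bound1 (real n))"
  using assms
proof (induction cs rs rule: check_small.induct)
  case (1 A C v g y u N s l h a b rs)
  note pr = "1.prems"(1)[unfolded check_small.simps]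
  have c: "v = 4" "A = 1385980" "C = 326300"
    "(u + 1) * 2000000000000 < v * (2000000 * A + C * C + 2000000000000)"
    using pr by blast+
  have ok: "row_ok (Row v g y u N s l h a b)" using "1.prems"(2) by simp
  have "real (lucky v) < real v * bound1 (real v)"
    by (rule lucky_less_bound1[OF _ ok c(4)]) (use c log_inv_4 in simp)
  moreover have "n = v" if "4 \<le> n" "n \<le> v" for n using that c(1) by simp
  ultimately show ?case using c log_inv_4 by auto
next
  case (2 A' C' A C cs v' g' y' u' N' s' l' h' a' b' v g y u N s l h a b rs)
  have ok: "row_ok (Row v' g' y' u' N' s' l' h' a' b')" using "2.prems"(2) by simp
  have c: "v' = v + 1" "A \<le> A'"
     "3 * ((v' + v) * ((v' + v) * (v' + v))) * A' \<le>
       3 * ((v' + v) * ((v' + v) * (v' + v))) * A + 2000000 * (3 * ((v' + v) * (v' + v)) + 1)"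
     "C' * (A' + A) + 2000000 * A \<le> C * (A' + A) + 2000000 * A'"
     "(u' + 1) * 2000000000000 < v' * (2000000 * A' + C' * C' + 2000000000000)"
     "check_small ((A, C) # cs) (Row v g y u N s l h a b # rs)"
    using "2.prems"(1)[unfolded check_small.simps] by blast+
  have IH: "log_inv v A C" "4 \<le> n \<Longrightarrow> n \<le> v \<Longrightarrow> real (lucky n) < real n * bound1 (real n)" for n
    using "2.IH"[OF c] "2.prems"(2) by auto
  have v1: "1 \<le> v" using IH(1) by (simp add: log_inv_def)
  define q where "q = real v' + real v"
  have q: "0 < q" "q = 2 * real v + 1" using v1 by (simp_all add: q_def c(1))
  have "real (3 * ((v' + v) * ((v' + v) * (v' + v))) * A') \<le>
    real (3 * ((v' + v) * ((v' + v) * (v' + v))) * A + 2000000 * (3 * ((v' + v) * (v' + v)) + 1))"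
    using c(3) by (rule of_nat_mono)
  then have "3 * (q * (q * q)) * real A' \<le> 3 * (q * (q * q)) * real A + 2000000 * (3 * (q * q) + 1)"
    by (simp only: q_def of_nat_add of_nat_mult of_nat_numeral of_nat_1)
  moreover have "x' \<le> x + z / d" if "d * x' \<le> d * x + z" "0 < d" for x x' z d :: real
    using that by (simp add: field_simps)
  ultimately have "real A' \<le> real A + 2000000 * (3 * (q * q) + 1) / (3 * (q * (q * q)))"
    using q(1) by simp
  also have "2000000 * (3 * (q * q) + 1) / (3 * (q * (q * q))) = 1000000 * (2 * (1 / q) + 2 / 3 * (1 / q) ^ 3)"
    using q(1) by (simp add: divide_simps power3_eq_cube)
  finally have "real A' / 1000000 \<le> real A / 1000000 + (2 * (1 / q) + 2 / 3 * (1 / q) ^ 3)" by simp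
  moreover have "ln (real v) + 2 * (1 / q) + 2 / 3 * (1 / q) ^ 3 \<le> ln (real v + 1)"
    using ln_add_ge3[of "real v" 1] v1 by (simp add: q(2))
  moreover have "real A / 1000000 \<le> ln (real v)" using IH(1) by (simp add: log_inv_def)
  ultimately have "real A' / 1000000 \<le> ln (real v + 1)" by linarith
  then have log: "log_inv v' A' C'"
    using c by (intro log_inv_step[OF IH(1)]) (auto simp: add.commute)
  have "real (lucky v') < real v' * bound1 (real v')"
    by (rule lucky_less_bound1[OF log ok c(5)])
  then have "real (lucky n) < real n * bound1 (real n)" if "4 \<le> n" "n \<le> v'" for n
    using that IH(2)[of n] by (cases "n = v'") (auto simp: c(1))
  then show ?case using log by simp
qed auto

text \<open>For \<open>v' < j <= v\<close> the ratio of \<open>(j - 1) * W (j - 1)\<close> to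
  \<open>lk j\<close> is at most \<open>v * W v / y'\<close>. The factor 1.44 supplies the base of
  the induction in \<open>growth_bound\<close>.\<close>

fun check_growth :: "nat \<Rightarrow> row list \<Rightarrow> bool" where
  "check_growth p (Row v g y u N s l h a b # Row v' g' y' u' N' s' l' h' a' b' # rs) =
    (v \<le> p \<or> v * h \<le> 144000 * y' \<and> check_growth p (Row v' g' y' u' N' s' l' h' a' b' # rs))"
| "check_growth p rs = False"

lemma check_growth_sound:
  assumes "check_growth p rs" "\<forall>r \<in> set rs. row_ok r" "p < j" "j \<le> row_v (hd rs)"
  shows "real (j - 1) * W (j - 1) \<le> 1.44 * real (lk j)"
  using assms
proof (induction p rs rule: check_growth.induct)
  case (1 p v g y u N s l h a b v' g' y' u' N' s' l' h' a' b' rs)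
  have ok: "row_ok (Row v g y u N s l h a b)" "row_ok (Row v' g' y' u' N' s' l' h' a' b')"
    using "1.prems"(2) by auto
  have j: "p < j" "j \<le> v" using "1.prems"(3,4) by auto
  then have c: "v * h \<le> 144000 * y'" "check_growth p (Row v' g' y' u' N' s' l' h' a' b' # rs)"
    using "1.prems"(1) by auto
  show ?case
  proof (cases "j \<le> v'")
    case True
    then show ?thesis using "1.IH"[OF c] "1.prems"(2) j by simp
  next
    case False
    have "100000 * W (j - 1) \<le> 100000 * W v" using j by (simp add: W_mono)
    also have "\<dots> \<le> real h" using ok by simp
    finally have "real (j - 1) * (100000 * W (j - 1)) \<le> real v * real h"
      using j W_pos[of "j - 1"] by (intro mult_mono) auto
    also have "\<dots> = real (v * h)" by simp
    also have "\<dots> \<le> real (144000 * y')" using c(1) by (rule of_nat_mono)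
    also have "y' \<le> lk j" using ok False lk_mono[of v' j] by auto
    then have "real (144000 * y') \<le> real (144000 * lk j)" by (intro of_nat_mono mult_le_mono2)
    finally show ?thesis by (simp add: mult_ac)
  qed
qed auto

section \<open>The grid\<close>

text \<open>All gaps are 1 and all tracks run down to row 1, so \<open>y = u\<close> is the exact
  value. The list stops at 62, the last index checked individually.\<close>

definition rows1 :: "row list" where
  "rows1 = [
    Row 62 1 330 330 331 2 802450 802511 15 1,
    Row 61 1 326 326 327 2 800026 800086 15 1,
    Row 60 1 320 320 321 2 797580 797639 15 1,
    Row 59 1 318 318 319 2 795096 795154 15 1,
    Row 58 1 306 306 307 2 792604 792661 15 1,
    Row 57 1 302 302 303 2 790023 790079 15 1,
    Row 56 1 296 296 297 2 787416 787471 15 1,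
    Row 55 1 288 288 289 2 784765 784819 15 1,
    Row 54 1 284 284 285 2 782050 782103 15 1,
    Row 53 1 282 282 283 2 779306 779358 15 1,
    Row 52 1 272 272 273 2 776553 776604 15 1,
    Row 51 1 266 266 267 2 773709 773759 14 1,
    Row 50 1 260 260 261 2 770812 770861 14 1,
    Row 49 1 258 258 259 2 767859 767907 13 1,
    Row 48 1 240 240 241 2 764895 764942 13 1,
    Row 47 1 236 236 237 2 761722 761767 13 1,
    Row 46 1 234 234 235 2 758508 758552 13 1,
    Row 45 1 230 230 231 2 755281 755324 13 1,
    Row 44 1 222 222 223 2 752012 752054 13 1,
    Row 43 1 218 218 219 2 748640 748681 12 1,
    Row 42 1 210 210 211 2 745222 745262 12 1,
    Row 41 1 204 204 205 2 741691 741729 12 1,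
    Row 40 1 200 200 201 2 738073 738110 12 1,
    Row 39 1 194 194 195 2 734401 734437 12 1,
    Row 38 1 192 192 193 2 730635 730670 12 1,
    Row 37 1 188 188 189 2 726850 726884 11 1,
    Row 36 1 170 170 171 2 723005 723038 11 1,
    Row 35 1 168 168 169 2 718777 718809 11 1,
    Row 34 1 162 162 163 2 714524 714555 11 1,
    Row 33 1 158 158 159 2 710141 710171 10 1,
    Row 32 1 150 150 151 2 705675 705704 10 1,
    Row 31 1 140 140 141 2 701002 701030 9 1,
    Row 30 1 134 134 135 2 696031 696058 9 1,
    Row 29 1 132 132 133 2 690876 690902 9 1,
    Row 28 1 128 128 129 2 685682 685707 9 1,
    Row 27 1 126 126 127 2 680367 680391 9 1,
    Row 26 1 114 114 115 2 675010 675033 9 1,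
    Row 25 1 110 110 111 2 669141 669163 8 1,
    Row 24 1 104 104 105 2 663113 663134 8 1,
    Row 23 1 98 98 99 2 656798 656818 8 1,
    Row 22 1 92 92 93 2 650164 650183 8 1,
    Row 21 1 86 86 87 2 643173 643191 7 1,
    Row 20 1 78 78 79 2 635781 635798 7 1,
    Row 19 1 74 74 75 2 627734 627749 7 1,
    Row 18 1 72 72 73 2 619365 619379 7 1,
    Row 17 1 68 68 69 2 610881 610894 7 1,
    Row 16 1 66 66 67 2 602028 602040 7 1,
    Row 15 1 62 62 63 2 593043 593054 6 1,
    Row 14 1 50 50 51 2 583630 583640 6 1,
    Row 13 1 48 48 49 2 572187 572196 5 1,
    Row 12 1 42 42 43 2 560510 560518 5 1,
    Row 11 1 36 36 37 2 547475 547482 5 1,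
    Row 10 1 32 32 33 2 532679 532685 5 1,
    Row 9 1 30 30 31 2 516538 516543 4 1,
    Row 8 1 24 24 25 2 499876 499880 4 1,
    Row 7 1 20 20 21 2 479881 479884 3 1,
    Row 6 1 14 14 15 2 457030 457032 3 1,
    Row 5 1 12 12 13 2 426562 426563 3 1,
    Row 4 1 8 8 9 2 393750 393750 3 1,
    Row 3 1 6 6 7 2 350000 350000 2 1,
    Row 2 1 2 2 3 2 300000 300000 1 1,
    Row 1 1 1 1 1 1 200000 200000 1 1]"

definition rows2 :: "row list" where
  "rows2 = 
    Row 528 27 4173 4269 3961 4 1095644 1116603 93 8 #
    Row 501 26 3959 4030 3696 4 1088758 1109092 89 8 #
    Row 475 24 3694 3765 3506 4 1081779 1101396 81 8 #
    Row 451 23 3504 3590 3293 4 1074927 1093956 81 8 #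
    Row 428 22 3291 3345 3097 4 1068085 1086419 77 7 #
    Row 406 21 3095 3139 2938 4 1061107 1078808 73 7 #
    Row 385 20 2936 2966 2766 4 1054056 1071204 68 7 #
    Row 365 19 2764 2793 2579 4 1046997 1063567 67 7 #
    Row 346 18 2577 2601 2433 4 1039923 1055843 64 6 #
    Row 328 17 2431 2455 2282 4 1032776 1048143 62 6 #
    Row 311 16 2280 2304 2150 4 1025674 1040447 59 6 #
    Row 295 15 2148 2171 2022 4 1018601 1032816 56 6 #
    Row 280 14 2020 2043 1907 4 1011612 1025264 53 6 #
    Row 266 13 1905 1929 1793 4 1004727 1017844 51 6 #
    Row 253 13 1791 1815 1691 4 998002 1010568 49 6 #
    Row 240 12 1689 1707 1576 4 990905 1002914 48 5 #
    Row 228 11 1574 1592 1490 4 983988 995390 45 5 #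
    Row 217 11 1488 1506 1411 4 977236 988146 43 5 #
    Row 206 10 1409 1422 1321 3 970150 980527 42 4 #
    Row 196 10 1319 1331 1246 3 963376 973184 40 4 #
    Row 186 9 1244 1257 1187 3 956192 965462 37 4 #
    Row 177 9 1185 1197 1100 3 949395 958220 37 4 #
    Row 168 8 1098 1111 1033 3 942310 950470 35 4 #
    Row 160 8 1031 1044 986 3 935574 943189 34 4 #
    Row 152 7 984 997 931 3 928460 935623 33 4 #
    Row 145 7 929 942 891 3 921987 928662 32 4 #
    Row 138 7 889 896 828 3 915187 921446 31 3 #
    Row 131 6 826 833 775 3 908093 913747 29 3 #
    Row 125 6 773 781 730 3 901599 906748 27 3 #
    Row 119 6 728 735 688 3 894726 899379 27 3 #
    Row 113 5 686 693 646 3 887482 891630 26 3 #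
    Row 108 5 644 651 620 3 881125 884801 25 3 #
    Row 103 5 618 621 590 3 874410 877744 24 2 #
    Row 98 5 588 591 551 3 867426 870391 23 2 #
    Row 93 4 549 552 527 3 860149 862590 22 2 #
    Row 89 4 525 528 494 3 853961 856109 22 2 #
    Row 85 4 492 495 476 3 847541 849252 21 2 #
    Row 81 4 474 477 431 3 840748 842195 21 2 #
    Row 77 4 429 432 413 3 833757 834475 20 2 #
    Row 73 3 411 414 394 3 826108 826497 18 2 #
    Row 70 1 392 392 393 2 820165 820235 18 1 #
    Row 69 1 390 390 391 2 818079 818147 17 1 #
    Row 68 1 384 384 385 2 815987 816054 17 1 #
    Row 67 1 366 366 367 2 813868 813934 16 1 #
    Row 66 1 360 360 361 2 811651 811716 16 1 #
    Row 65 1 356 356 357 2 809403 809467 16 1 #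
    Row 64 1 348 348 349 2 807136 807199 16 1 #
    Row 63 1 338 338 339 2 804824 804886 15 1 #
    rows1"

definition rows3 :: "row list" where
  "rows3 = 
    Row 5781 301 61932 64426 58313 7 1396746 1451342 725 60 #
    Row 5480 285 58311 60607 55100 7 1390251 1443981 688 57 #
    Row 5195 270 55098 56963 51992 7 1383745 1436642 653 55 #
    Row 4925 256 51990 53835 48906 7 1377218 1429312 619 52 #
    Row 4669 243 48904 50659 46232 7 1370700 1421962 587 49 #
    Row 4426 230 46230 47748 43483 7 1364157 1414620 557 48 #
    Row 4196 218 43481 45192 40922 7 1357618 1407271 557 45 #
    Row 3978 207 40920 42466 38718 7 1351101 1399909 528 43 #
    Row 3771 196 38716 39965 36230 7 1344548 1392559 501 41 #
    Row 3575 186 36228 37574 34323 7 1337987 1385163 475 39 #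
    Row 3389 176 34321 35400 32342 7 1331397 1377794 451 37 #
    Row 3213 167 32340 33412 30485 7 1324811 1370434 428 36 #
    Row 3046 158 30483 31434 28784 7 1318223 1363065 406 35 #
    Row 2888 150 28782 29586 26972 7 1311631 1355721 385 33 #
    Row 2738 142 26970 27805 25455 7 1305015 1348323 365 32 #
    Row 2596 135 25453 26331 24105 7 1298385 1340943 365 31 #
    Row 2461 128 24103 24745 22663 6 1291763 1333555 346 30 #
    Row 2333 121 22661 23246 21345 6 1285116 1326146 328 28 #
    Row 2212 115 21343 21885 20016 6 1278462 1318752 311 26 #
    Row 2097 109 20014 20657 18911 6 1271780 1311301 295 26 #
    Row 1988 103 18909 19433 17773 6 1265105 1303869 280 25 #
    Row 1885 98 17771 18310 16684 6 1258435 1296440 266 24 #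
    Row 1787 93 16682 17209 15664 6 1251736 1288954 253 23 #
    Row 1694 88 15662 16301 14904 6 1245008 1281433 253 22 #
    Row 1606 83 14902 15276 14046 6 1238323 1273996 240 21 #
    Row 1523 79 14044 14401 13213 6 1231632 1266597 228 20 #
    Row 1444 75 13211 13549 12424 6 1224913 1259155 217 20 #
    Row 1369 71 12422 12725 11664 6 1218170 1251687 206 19 #
    Row 1298 67 11662 11998 11003 6 1211411 1244202 196 18 #
    Row 1231 64 11001 11284 10344 6 1204684 1236759 186 17 #
    Row 1167 60 10342 10628 9731 5 1197890 1229222 177 15 #
    Row 1107 57 9729 10080 9246 5 1191166 1221756 177 14 #
    Row 1050 54 9244 9432 8604 5 1184469 1214337 168 14 #
    Row 996 51 8602 8889 8178 5 1177727 1206832 160 14 #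
    Row 945 49 8176 8370 7612 5 1171009 1199420 152 14 #
    Row 896 46 7610 7862 7260 5 1164194 1191819 145 13 #
    Row 850 44 7258 7399 6806 5 1157423 1184383 138 12 #
    Row 806 42 6804 6951 6397 5 1150581 1176846 131 12 #
    Row 764 39 6395 6525 6040 5 1143671 1169242 125 12 #
    Row 725 37 6038 6143 5668 5 1136876 1161810 119 11 #
    Row 688 35 5666 5831 5394 5 1130070 1154346 119 11 #
    Row 653 34 5392 5481 5014 5 1123328 1146974 113 11 #
    Row 619 32 5012 5114 4732 5 1116403 1139324 103 10 #
    Row 587 30 4730 4816 4490 5 1109461 1131746 98 10 #
    Row 557 29 4488 4572 4175 5 1102593 1124307 98 9 #
    rows2"

definition rows4 :: "row list" where
  "rows4 = 
    Row 64234 3348 859402 907910 815335 10 1681201 1777361 6098 428 #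
    Row 60886 3174 815333 856924 769028 10 1675025 1770206 5781 428 #
    Row 57712 3008 769026 807974 726288 10 1668844 1763044 5480 406 #
    Row 54704 2851 726286 761230 684696 10 1662655 1755887 5195 385 #
    Row 51853 2703 684694 718334 644920 10 1656452 1748721 4925 365 #
    Row 49150 2562 644918 680734 607935 10 1650243 1741539 4925 346 #
    Row 46588 2428 607933 643162 573794 10 1644056 1734348 4669 328 #
    Row 44160 2302 573792 605946 540542 10 1637873 1727158 4426 311 #
    Row 41858 2182 540540 571258 509638 10 1631675 1719952 4196 311 #
    Row 39676 2068 509636 538191 484301 10 1625467 1712739 3978 295 #
    Row 37608 1960 484299 507045 457082 10 1619246 1705575 3771 280 #
    Row 35648 1858 457080 477410 430849 10 1613011 1698411 3575 266 #
    Row 33790 1761 430847 449845 406084 9 1606758 1691223 3389 253 #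
    Row 32029 1669 406082 424775 382143 9 1600493 1684026 3213 240 #
    Row 30360 1582 382141 400864 360426 9 1594230 1676810 3046 228 #
    Row 28778 1500 360424 377681 339493 9 1587964 1669589 2888 228 #
    Row 27278 1422 339491 358381 319996 9 1581683 1662353 2888 217 #
    Row 25856 1347 319994 337115 302068 9 1575432 1655107 2738 206 #
    Row 24509 1277 302066 317190 285234 9 1569163 1647868 2596 196 #
    Row 23232 1211 285232 298946 270646 9 1562871 1640633 2461 186 #
    Row 22021 1148 270644 281612 254661 9 1556566 1633434 2333 177 #
    Row 20873 1088 254659 265296 239742 9 1550247 1626214 2212 168 #
    Row 19785 1031 239740 250530 226128 9 1543916 1618978 2097 160 #
    Row 18754 977 226126 236461 212934 9 1537589 1611742 1988 152 #
    Row 17777 926 212932 224124 200794 9 1531263 1604493 1988 145 #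
    Row 16851 878 200792 210781 189039 9 1524963 1597241 1885 138 #
    Row 15973 832 189037 198256 178669 9 1518638 1589971 1787 131 #
    Row 15141 789 178667 187008 168591 9 1512292 1582716 1694 131 #
    Row 14352 748 168589 176191 159370 9 1505939 1575458 1606 125 #
    Row 13604 709 159368 166098 150048 8 1499573 1568197 1523 119 #
    Row 12895 672 150046 156285 141589 8 1493200 1560922 1444 113 #
    Row 12223 637 141587 147798 133375 8 1486807 1553649 1369 108 #
    Row 11586 604 133373 139211 125752 8 1480427 1546365 1298 103 #
    Row 10982 572 125750 130872 118289 8 1474032 1539075 1231 98 #
    Row 10410 542 118287 123860 111554 8 1467618 1531771 1231 93 #
    Row 9868 514 111552 116851 105359 8 1461224 1524468 1167 89 #
    Row 9354 487 105357 109953 99176 8 1454825 1517170 1107 85 #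
    Row 8867 462 99174 103624 93949 8 1448410 1509860 1050 81 #
    Row 8405 438 93947 97459 88371 8 1441982 1502575 996 77 #
    Row 7967 415 88369 92001 83405 8 1435531 1495269 945 77 #
    Row 7552 393 83403 86593 78401 8 1429085 1487971 896 73 #
    Row 7159 373 78399 81474 73844 8 1422629 1480656 850 70 #
    Row 6786 353 73842 76779 69788 8 1416146 1473322 806 67 #
    Row 6433 335 69786 72739 65643 8 1409665 1466014 806 65 #
    Row 6098 317 65641 68569 61934 8 1403203 1458679 764 63 #
    rows3"

definition rows5 :: "row list" where
  "rows5 = 
    Row 642057 33472 10195918 10907376 9657198 13 1940886 2083379 49150 3389 #
    Row 608585 31727 9657196 10334197 9113839 13 1934949 2076313 49150 3213 #
    Row 576858 30073 9113837 9749255 8628632 13 1929027 2069241 46588 3046 #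
    Row 546785 28505 8628630 9199476 8139484 13 1923095 2062185 44160 2888 #
    Row 518280 27019 8139482 8682405 7687440 13 1917155 2055120 41858 2738 #
    Row 491261 25610 7687438 8212432 7251416 12 1911208 2048043 39676 2596 #
    Row 465651 24275 7251414 7749542 6838078 12 1905267 2040956 37608 2461 #
    Row 441376 23010 6838076 7306786 6450520 12 1899318 2033858 35648 2333 #
    Row 418366 21810 6450518 6890097 6100630 12 1893356 2026751 33790 2212 #
    Row 396556 20673 6100628 6498045 5758787 12 1887382 2019654 32029 2212 #
    Row 375883 19595 5758785 6132221 5435272 12 1881397 2012553 30360 2097 #
    Row 356288 18574 5435270 5798215 5150411 12 1875405 2005447 28778 1988 #
    Row 337714 17605 5150409 5472170 4858089 12 1869417 1998364 27278 1885 #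
    Row 320109 16688 4858087 5180822 4596969 12 1863423 1991273 27278 1787 #
    Row 303421 15818 4596967 4887719 4335705 12 1857440 1984195 25856 1694 #
    Row 287603 14993 4335703 4610172 4088539 12 1851449 1977107 24509 1606 #
    Row 272610 14211 4088537 4357626 3856101 12 1845448 1970009 23232 1523 #
    Row 258399 13471 3856099 4110273 3637405 12 1839450 1962902 22021 1444 #
    Row 244928 12768 3637403 3874622 3443524 12 1833442 1955787 20873 1444 #
    Row 232160 12103 3443522 3652774 3248497 12 1827421 1948689 19785 1369 #
    Row 220057 11472 3248495 3449128 3063380 12 1821387 1941584 18754 1298 #
    Row 208585 10874 3063378 3259800 2890977 12 1815350 1934469 17777 1231 #
    Row 197711 10307 2890975 3074518 2734931 11 1809315 1927337 16851 1167 #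
    Row 187404 9769 2734929 2897835 2587213 11 1803270 1920218 15973 1107 #
    Row 177635 9260 2587211 2735222 2440275 11 1797212 1913112 15141 1050 #
    Row 168375 8777 2440273 2575851 2302030 11 1791149 1905997 14352 996 #
    Row 159598 8320 2302028 2440712 2172914 11 1785067 1898876 14352 945 #
    Row 151278 7886 2172912 2306809 2052953 11 1779003 1891752 13604 945 #
    Row 143392 7475 2052951 2179385 1935618 11 1772943 1884632 12895 896 #
    Row 135917 7085 1935616 2052276 1826572 11 1766883 1877502 12223 850 #
    Row 128832 6716 1826570 1935218 1722141 11 1760805 1870368 11586 806 #
    Row 122116 6366 1722139 1827619 1623801 11 1754716 1863223 10982 764 #
    Row 115750 6034 1623799 1725567 1531970 11 1748626 1856069 10410 725 #
    Row 109716 5719 1531968 1624489 1453745 11 1742533 1848910 9868 688 #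
    Row 103997 5421 1453743 1531119 1372239 11 1736420 1841787 9354 653 #
    Row 98576 5139 1372237 1443068 1292908 11 1730294 1834662 8867 619 #
    Row 93437 4871 1292906 1362848 1220386 11 1724155 1827522 8405 619 #
    Row 88566 4617 1220384 1293496 1153148 11 1718015 1820381 8405 587 #
    Row 83949 4376 1153146 1218345 1086606 11 1711905 1813246 7967 557 #
    Row 79573 4148 1086604 1149889 1024588 10 1705779 1806085 7552 528 #
    Row 75425 3932 1024586 1084582 965803 10 1699648 1798915 7159 501 #
    Row 71493 3727 965801 1023120 911464 10 1693509 1791734 6786 475 #
    Row 67766 3532 911462 963623 859404 10 1687363 1784551 6433 451 #
    rows4"

text \<open>Above 677370 the ratio of consecutive indices is about 1.07 instead of 1.055: these rows
  only have to yield the factor 1.44 and the enclosure of \<open>W\<close> at the last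
  index.\<close>

definition rows6 :: "row list" where
  "rows6 = 
    Row 3676350 240508 65384731 70661158 60675501 15 2130029 2313719 258399 15973 #
    Row 3435842 224774 60675499 65445355 56518148 15 2122804 2304805 232160 15141 #
    Row 3211068 210069 56518146 61017379 52674063 15 2115539 2295896 220057 14352 #
    Row 3000999 196327 52674061 56783128 49003168 14 2108281 2286981 208585 13604 #
    Row 2804672 183483 49003166 52812647 45660589 14 2101017 2278061 197711 12223 #
    Row 2621189 171479 45660587 49158124 42579951 14 2093743 2269150 187404 11586 #
    Row 2449710 160261 42579949 45839810 39482551 14 2086465 2260255 177635 10982 #
    Row 2289449 149777 39482549 42533559 36729313 14 2079196 2251327 159598 10410 #
    Row 2139672 139978 36729311 39576592 34229648 14 2071901 2242394 151278 9868 #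
    Row 1999694 130821 34229646 36833960 31846221 14 2064599 2233472 143392 9354 #
    Row 1868873 122262 31846219 34316310 29667776 14 2057293 2224546 135917 8867 #
    Row 1746611 114264 29667774 31896675 27645865 14 2049990 2215628 128832 7967 #
    Row 1632347 106789 27645863 29703592 25665438 14 2042673 2206720 122116 7552 #
    Row 1525558 99802 25665436 27565477 23902224 14 2035356 2197790 109716 7159 #
    Row 1425756 93273 23902222 25689948 22223624 14 2028014 2188866 103997 6786 #
    Row 1332483 87171 22223622 23889065 20673925 14 2020678 2179934 98576 6433 #
    Row 1245312 81469 20673923 22194735 19270012 14 2013332 2170998 93437 6098 #
    Row 1163843 76139 19270010 20684048 17947160 13 2005969 2162058 88566 5781 #
    Row 1087704 71158 17947158 19249581 16640376 13 1998613 2153125 83949 5195 #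
    Row 1016546 66503 16640374 17840316 15512995 13 1991253 2144160 75425 4925 #
    Row 950043 62152 15512993 16627471 14458579 13 1983858 2135210 71493 4669 #
    Row 887891 58086 14458577 15490344 13453982 13 1976471 2126274 67766 4426 #
    Row 829805 54286 13453980 14367632 12492687 13 1969088 2117337 64234 4196 #
    Row 775519 50734 12492685 13379827 11642375 13 1961677 2108382 60886 3978 #
    Row 724785 47415 11642373 12408356 10791335 13 1954267 2099440 54704 3771 #
    Row 677370 35313 10791333 11534003 10195920 13 1946828 2090464 51853 3575 #
    rows5"

text \<open>Paired with the rows of \<open>rows5\<close> down to row 15; the logarithms are those of
  \<open>y + 1\<close>, a lower bound for the lucky number of the row.\<close>

definition logs1 :: "(nat \<times> nat) list" where
  "logs1 = [
    (16132730, 2780352), (16078460, 2776983), (16020567, 2773376),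
    (15965873, 2769957), (15907531, 2766297), (15850408, 2762700),
    (15792034, 2759011), (15733361, 2755289), (15675032, 2751575),
    (15619278, 2748012), (15561629, 2744315), (15503828, 2740594),
    (15450008, 2737117), (15391594, 2733329), (15336361, 2729735),
    (15277865, 2725914), (15219186, 2722066), (15160672, 2718214),
    (15102303, 2714357), (15047542, 2710725), (14989256, 2706845),
    (14930600, 2702925), (14872692, 2699039), (14817218, 2695303),
    (14761708, 2691550), (14703255, 2687583), (14644953, 2683610),
    (14587247, 2679662), (14530473, 2675763), (14471638, 2671706),
    (14413669, 2667693), (14354814, 2663602), (14296033, 2659499),
    (14237835, 2655420), (14185436, 2651733), (14127753, 2647659),
    (14068221, 2643437), (14010511, 2639327), (13953855, 2635275),
    (13894436, 2631008), (13835685, 2626771), (13776617, 2622493),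
    (13718726, 2618283), (13659930, 2613988), (13607303, 2610128),
    (13548848, 2605823), (13491683, 2601595), (13432729, 2597216),
    (13372899, 2592753), (13313858, 2588329), (13256077, 2583980),
    (13196397, 2579468), (13137543, 2574999), (13086560, 2571111),
    (13028733, 2566683), (12969645, 2562138), (12910465, 2557565),
    (12849719, 2552849), (12791228, 2548287), (12731413, 2543600),
    (12672286, 2538946), (12614646, 2534388), (12557320, 2529834),
    (12504834, 2525646), (12443975, 2520768), (12383624, 2515907),
    (12325179, 2511177), (12265078, 2506289), (12206392, 2501493),
    (12146084, 2496541), (12089681, 2491887), (12031638, 2487075),
    (11975406, 2482391), (11915151, 2477347), (11857141, 2472467),
    (11797395, 2467416), (11738559, 2462417), (11677397, 2457194),
    (11618792, 2452163), (11561672, 2447235), (11501213, 2441993),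
    (11447082, 2437276), (11385893, 2431917), (11328073, 2426826),
    (11266221, 2421351), (11206357, 2416024), (11149879, 2410972),
    (11088667, 2405467), (11030521, 2400210), (10970294, 2394736),
    (10913633, 2389558), (10855589, 2384226), (10794418, 2378576),
    (10738204, 2373355), (10676920, 2367632), (10616235, 2361933),
    (10560885, 2356706), (10494491, 2350400), (10440431, 2345236),
    (10380998, 2339528), (10321882, 2333818), (10264481, 2328242),
    (10199482, 2321890), (10141609, 2316200), (10087128, 2310814),
    (10025460, 2304682), (9965560, 2298690), (9901294, 2292221),
    (9844519, 2286471), (9782473, 2280149), (9719261, 2273667),
    (9656193, 2267157), (9606465, 2261994), (9547187, 2255805),
    (9486066, 2249383), (9424510, 2242873), (9361403, 2236155),
    (9303076, 2229905), (9241329, 2223246), (9180252, 2216615),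
    (9129133, 2211032), (9057193, 2203121), (9006419, 2197500),
    (8934719, 2189508), (8887376, 2184196), (8822814, 2176906),
    (8760849, 2169858), (8703431, 2163283), (8639874, 2155954),
    (8590327, 2150203), (8517293, 2141665), (8459412, 2134847),
    (8406918, 2128623), (8334195, 2119936), (8281577, 2113603),
    (8212342, 2105208), (8159565, 2098761), (8096891, 2091051),
    (8035526, 2083444), (7982816, 2076863), (7922487, 2069277),
    (7852489, 2060403), (7794206, 2052954), (7730128, 2044699),
    (7670535, 2036960), (7609145, 2028925), (7550577, 2021199),
    (7488923, 2013001), (7430336, 2005148), (7359892, 1995623),
    (7303757, 1987967), (7249256, 1980478), (7183322, 1971342),
    (7124843, 1963168), (7076304, 1956333), (7000156, 1945514),
    (6937275, 1936491), (6890672, 1929751), (6833231, 1921381),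
    (6789275, 1914928), (6715892, 1904061), (6649684, 1894154),
    (6589804, 1885109), (6530482, 1876067), (6467419, 1866364),
    (6426280, 1859983), (6376612, 1852225), (6308131, 1841428),
    (6263522, 1834332), (6198753, 1823938), (6161563, 1817921),
    (6062116, 1801650), (6019361, 1794573), (5972157, 1786701),
    (5967055, 1785847), (5951592, 1783253), (5903720, 1775177),
    (5887237, 1772382), (5876095, 1770488), (5853433, 1766624),
    (5824364, 1761646), (5800484, 1757538), (5788326, 1755440),
    (5769808, 1752236), (5763558, 1751153), (5725220, 1744480),
    (5712106, 1742187), (5692106, 1738680), (5664803, 1733872),
    (5650866, 1731409), (5643824, 1730163), (5607853, 1723770),
    (5585631, 1719800), (5562904, 1715723), (5555212, 1714340),
    (5483212, 1701295), (5466476, 1698239), (5458002, 1696688),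
    (5440835, 1693538), (5405593, 1687040), (5387494, 1683687),
    (5350285, 1676757), (5321439, 1671351), (5301735, 1667642),
    (5271432, 1661910), (5261123, 1659953), (5240181, 1655965),
    (5140181, 1636698), (5128417, 1634407), (5092273, 1627335),
    (5067429, 1622445), (5015817, 1612208), (4947324, 1598459),
    (4903846, 1589633), (4888921, 1586585), (4858387, 1580320),
    (4842762, 1577099), (4743589, 1556409), (4708191, 1548919),
    (4652636, 1537050), (4593813, 1524327), (4531313, 1510629),
    (4464647, 1495808), (4368262, 1473984), (4316314, 1462021),
    (4289287, 1455740), (4232949, 1442519), (4203538, 1435547),
    (4142000, 1420800)]"

text \<open>Paired with the rows of \<open>rows1\<close> down to row 4; the logarithms are those of
  the index \<open>v\<close> itself.\<close>

definition logs2 :: "(nat \<times> nat) list" where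
  "logs2 = [
    (4126778, 1416863), (4110518, 1412916), (4093989, 1408887),
    (4077182, 1404774), (4060088, 1400573), (4042697, 1396281),
    (4024998, 1391894), (4006980, 1387408), (3988631, 1382819),
    (3969939, 1378122), (3950891, 1373313), (3931473, 1368387),
    (3911671, 1363338), (3891469, 1358161), (3870850, 1352849),
    (3849797, 1347396), (3828291, 1341795), (3806313, 1336038),
    (3783841, 1330117), (3760852, 1324023), (3737322, 1317747),
    (3713225, 1311279), (3688533, 1304608), (3663216, 1297721),
    (3637241, 1290606), (3610573, 1283248), (3583175, 1275631),
    (3555005, 1267739), (3526018, 1259552), (3496166, 1251050),
    (3465395, 1242210), (3433647, 1233007), (3400858, 1223412),
    (3366957, 1213394), (3331866, 1202918), (3295499, 1191944),
    (3257759, 1180427), (3218539, 1168316), (3177718, 1155552),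
    (3135159, 1142069), (3090708, 1127790), (3044188, 1112625),
    (2995398, 1096469), (2944105, 1079198), (2890038, 1060664),
    (2832880, 1040689), (2772256, 1019058), (2707718, 995504),
    (2638726, 969696), (2564619, 941212), (2484577, 909508),
    (2397566, 873864), (2302256, 833306), (2196896, 786471),
    (2079114, 731382), (1945584, 665027), (1791435, 582529),
    (1609116, 475300), (1385980, 326300)]"

section \<open>Evaluation of the tests on the grid\<close>

lemma locate_eval:
  "v \<noteq> e \<Longrightarrow> locate e t (Row v g y u N s l h a b # rs) n Y U S = locate e t rs n Y U S"
  "locate e t (Row e g y u N s l h a b # rs) n Y U S =
    (n \<le> y + 1 \<and> track t (Row e g y u N s l h a b # rs) 0 n 0 n Y U S)"
  by simp_all

lemmas arith_eval = arith_simps rel_simps arith_special if_True if_False simp_thms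
  mult_zero_left mult_1 mult_1_right add_0 add_0_right zero_less_one

lemmas valid_eval = arith_eval locate_eval track.simps(2) step_ok.simps valid.simps

text \<open>Keeps the tails \<open>rows1\<close>, \<open>rows2\<close>, ... folded: their validity
  is cited as a fact, and a tail is opened only where a test actually walks into it.\<close>

lemma row_list_cong:
  assumes "r = (r' :: row list)"
  shows "step_ok x r = step_ok x r'" "locate e t r n Y U S = locate e t r' n Y U S"
    "track t r q z p k Y U S = track t r' q z p k Y U S"
  using assms by simp_all

lemma valid_rows1: "valid rows1"
  unfolding rows1_def
  \<comment> \<open>The weak congruence decides a condition before the branches are touched; they
    contain the recursive calls of \<open>track\<close>.\<close>
  by (simp only: valid_eval cong: if_weak_cong)

lemma valid_rows2: "valid rows2"
  unfolding rows2_def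
  by (simp only: valid_eval valid_rows1 row_list_cong[OF rows1_def] cong: if_weak_cong)

lemma valid_rows3: "valid rows3"
  unfolding rows3_def
  by (simp only: valid_eval valid_rows2 row_list_cong[OF rows2_def] row_list_cong[OF rows1_def] cong:
    if_weak_cong)

lemma valid_rows4: "valid rows4"
  unfolding rows4_def
  by (simp only: valid_eval valid_rows3 row_list_cong[OF rows3_def] row_list_cong[OF rows2_def] row_list_cong[OF
    rows1_def] cong: if_weak_cong)

lemma valid_rows5: "valid rows5"
  unfolding rows5_def
  by (simp only: valid_eval valid_rows4 row_list_cong[OF rows4_def] row_list_cong[OF rows3_def] row_list_cong[OF
    rows2_def] row_list_cong[OF rows1_def] cong: if_weak_cong)

lemma valid_rows6: "valid rows6"
  unfolding rows6_def
  by (simp only: valid_eval valid_rows5 row_list_cong[OF rows5_def] row_list_cong[OF rows4_def] row_list_cong[OF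
    rows3_def] row_list_cong[OF rows2_def] row_list_cong[OF rows1_def] cong: if_weak_cong)

lemma check_blocks_rows: "check_blocks logs1 rows5"
  unfolding rows5_def rows4_def rows3_def rows2_def rows1_def logs1_def
  by (simp only: arith_eval check_blocks.simps)

lemma check_small_rows: "check_small logs2 rows1"
  unfolding rows1_def logs2_def by (simp only: arith_eval check_small.simps)

lemma check_growth_rows: "check_growth 187404 rows6"
  unfolding rows6_def rows5_def rows4_def rows3_def rows2_def rows1_def
  by (simp only: arith_eval check_growth.simps)

section \<open>Growth of \<open>W\<close> beyond the grid\<close>

text \<open>With \<open>x = exp t\<close> this is \<open>t <= sinh t\<close>; the error is cubic in
  \<open>t\<close>, so it is sharp near 1.\<close>

lemma ln_le_half:
  fixes x :: real
  assumes "1 \<le> x"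
  shows "ln x \<le> (x - 1 / x) / 2"
proof -
  define f where "f x = (x - 1 / x) / 2 - ln x" for x :: real
  have "f 1 \<le> f x"
  proof (rule DERIV_nonneg_imp_nondecreasing[OF assms])
    fix x :: real assume x: "1 \<le> x"
    have "(f has_real_derivative (1 - (0 * x - 1 * 1) / (x * x)) / 2 - 1 / x) (at x)"
      unfolding f_def using x by (auto intro!: derivative_eq_intros)
    moreover have "(1 - (0 * x - 1 * 1) / (x * x)) / 2 - 1 / x = (x - 1)\<^sup>2 / (2 * x\<^sup>2)"
      using x by (simp add: field_simps power2_eq_square)
    ultimately show "\<exists>y. (f has_real_derivative y) (at x) \<and> 0 \<le> y"
      by (metis divide_nonneg_nonneg mult_nonneg_nonneg zero_le_numeral zero_le_power2)
  qed
  then show ?thesis by (simp add: f_def)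
qed

lemma ln_2_le: "ln (2 :: real) \<le> 0.694"
proof -
  \<comment> \<open>1.04428 is just above the 16th root of 2.\<close>
  have "ln (2::real) \<le> ln (1.04428 ^ 16)" by (subst ln_le_cancel_iff) (simp_all add: power_divide)
  also have "\<dots> = 16 * ln 1.04428" by (subst ln_realpow) auto
  finally show ?thesis using ln_le_half[of "1.04428"] by simp
qed

lemma ln_pow2_mult_le:
  fixes x :: real
  assumes "1 \<le> x"
  shows "ln (2 ^ k * x) \<le> real k * 0.694 + (x - 1 / x) / 2"
proof -
  have "ln (2 ^ k * x) = real k * ln 2 + ln x"
    using assms by (simp add: ln_mult ln_realpow)
  moreover have "real k * ln 2 \<le> real k * 0.694" by (intro mult_left_mono ln_2_le) auto
  ultimately show ?thesis using ln_le_half[OF assms] by linarith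
qed

text \<open>At \<open>y = W (n - 1) - 13\<close> this bounds the relative excess of
  \<open>(n - 1) * W (n - 1)\<close> over \<open>lk n\<close>.\<close>

definition G :: "real \<Rightarrow> real" where
  "G y = (ln y + 2.2) / y"

lemma G_antimono:
  assumes "1 \<le> y" "y \<le> z"
  shows "G z \<le> G y"
proof -
  have "ln z \<le> ln y + (z - y) / y"
    using ln_diff_le[of z y] assms by simp
  then have "y * ln z \<le> y * (ln y + (z - y) / y)" using assms by (intro mult_left_mono) auto
  also have "\<dots> = y * ln y + (z - y)" using assms by (simp add: field_simps)
  finally have "y * ln z \<le> y * ln y + (z - y)" .
  moreover have "0 \<le> (z - y) * (ln y + 1.2)" using assms by (intro mult_nonneg_nonneg) auto
  then have "0 \<le> z * ln y - y * ln y + 1.2 * z - 1.2 * y" by (simp add: field_simps)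
  ultimately have "y * ln z + 2.2 * y \<le> z * ln y + 2.2 * z" by linarith
  then have "y * (ln z + 2.2) \<le> z * (ln y + 2.2)" by (simp only: distrib_left mult.commute)
  then show ?thesis using assms by (simp add: G_def divide_simps mult.commute)
qed

text \<open>The right side of the growth step against its left side at \<open>D = 5.2\<close>, a
  bound for \<open>D\<close> that works for \<open>y <= 60\<close>. After division by
  \<open>y + 12\<close> and scaling by 25 the claim is \<open>f y >= 100\<close>, and completing a
  square shows that \<open>f\<close> increases.\<close>

lemma ln_lower_aux:
  fixes y :: real
  assumes "5 \<le> y"
  shows "6.2 * (y + 5.2) \<le> (y + 12) * (ln y + 2.2)"
proof -
  define f where "f y = 25 * ln y + 1054 / (y + 12)" for y :: real
  have "f 5 \<le> f y"
  proof (rule DERIV_nonneg_imp_nondecreasing[OF assms])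
    fix x :: real assume x: "5 \<le> x"
    have "(f has_real_derivative 25 / x + (0 * (x + 12) - 1054 * 1) / ((x + 12) * (x + 12))) (at x)"
      unfolding f_def using x by (auto intro!: derivative_eq_intros)
    moreover have "0 \<le> ((5 * x - 45.4)\<^sup>2 + 1538.84) / (x * ((x + 12) * (x + 12)))"
      using x by (intro divide_nonneg_nonneg add_nonneg_nonneg) auto
    moreover have "25 / x + (0 * (x + 12) - 1054 * 1) / ((x + 12) * (x + 12))
        = ((5 * x - 45.4)\<^sup>2 + 1538.84) / (x * ((x + 12) * (x + 12)))"
      using x by (simp add: divide_simps) (simp add: algebra_simps power2_eq_square)
    ultimately show "\<exists>y. (f has_real_derivative y) (at x) \<and> 0 \<le> y"
      by metis
  qed
  moreover have "ln (4::real) + 2 * 1 / (2 * 4 + 1) \<le> ln (4 + 1)" by (rule ln_add_ge) auto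
  moreover have "ln (4::real) = 2 * ln 2" using ln_realpow[of 2 2] by simp
  ultimately have "100 \<le> 25 * ln y + 1054 / (y + 12)" using ln_2_ge by (simp add: f_def)
  then have "100 * (y + 12) \<le> (25 * ln y + 1054 / (y + 12)) * (y + 12)"
    using assms by (intro mult_right_mono) auto
  also have "\<dots> = 25 * (ln y * (y + 12)) + 1054" using assms by (simp add: field_simps)
  finally show ?thesis by (simp add: field_simps)
qed

text \<open>With \<open>y = w - 13\<close>, this is the induction step for the growth rate of \<open>W\<close>: \<open>D\<close> bounds
  the increase of \<open>W\<close> from an index \<open>p\<close> with \<open>W p = w\<close> to the index \<open>p w\<close>.\<close>

lemma growth_step_small:
  fixes y :: real
  assumes y: "a \<le> y" "y \<le> b" "5 \<le> a" and la: "ln a \<le> \<alpha>" and lb: "ln (b + 13) \<le> \<beta>"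
    and num: "(1 + (\<alpha> + 2.2) / a) * (\<beta> + 0.001) \<le> 5.2"
  defines "D \<equiv> (1 + G y) * (ln (y + 13) + 0.001)"
  shows "(D + 1) * (y + D) \<le> (y + 12) * (ln y + 2.2)"
proof -
  have "G y \<le> G a" using y by (intro G_antimono) auto
  also have "\<dots> \<le> (\<alpha> + 2.2) / a" unfolding G_def using y la by (intro divide_right_mono) auto
  finally have G: "G y \<le> (\<alpha> + 2.2) / a" .
  have G0: "0 \<le> G y" using y by (simp add: G_def)
  have "ln (y + 13) \<le> ln (b + 13)" using y by simp
  then have l: "ln (y + 13) \<le> \<beta>" using lb by simp
  have l0: "0 \<le> ln (y + 13)" using y by simp
  have "D \<le> (1 + (\<alpha> + 2.2) / a) * (\<beta> + 0.001)"
    unfolding D_def using G G0 l l0 by (intro mult_mono) auto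
  then have D: "D \<le> 5.2" using num by (rule order_trans)
  have D0: "0 \<le> D" unfolding D_def using G0 l0 by simp
  have "(D + 1) * (y + D) \<le> (5.2 + 1) * (y + 5.2)"
    using D D0 y by (intro mult_mono) auto
  also have "\<dots> \<le> (y + 12) * (ln y + 2.2)" using ln_lower_aux[of y] y by simp
  finally show ?thesis .
qed

text \<open>Up to 60, six intervals are fine enough for \<open>D <= 5.2\<close>. Beyond, the terms
  \<open>y * ln y\<close> on both sides cancel and about \<open>1.2 * y\<close> remains to dominate
  a quadratic polynomial in \<open>ln y\<close>.\<close>

lemma growth_step:
  fixes y :: real
  assumes y: "5 \<le> y"
  defines "D \<equiv> (1 + G y) * (ln (y + 13) + 0.001)"
  shows "(D + 1) * (y + D) \<le> (y + 12) * (ln y + 2.2)"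
proof -
  have l5: "ln (5::real) \<le> 1.613" using ln_pow2_mult_le[of "5/4" 2] by simp
  have l56: "ln (5.6::real) \<le> 1.731" using ln_pow2_mult_le[of "1.4" 2] by simp
  have l186: "ln (5.6 + 13::real) \<le> 2.928" using ln_pow2_mult_le[of "1.1625" 4] by simp
  have l206: "ln (7.6 + 13::real) \<le> 3.032" using ln_pow2_mult_le[of "1.2875" 4] by simp
  have "ln (7.6::real) \<le> ln 8" by (subst ln_le_cancel_iff) auto
  moreover have "ln (8::real) \<le> 2.082" using ln_pow2_mult_le[of 1 3] by simp
  ultimately have l76: "ln (7.6::real) \<le> 2.082" by (rule order_trans)
  have l26: "ln (26::real) \<le> 3.281" using ln_pow2_mult_le[of "1.625" 4] by simp
  have l13: "ln (13::real) \<le> 2.587" using ln_pow2_mult_le[of "1.625" 3] by simp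
  have l39: "ln (39::real) \<le> 3.670" using ln_pow2_mult_le[of "1.21875" 5] by simp
  have l58: "ln (58::real) \<le> 4.101" using ln_pow2_mult_le[of "1.8125" 5] by simp
  have l45: "ln (45::real) \<le> 3.818" using ln_pow2_mult_le[of "1.40625" 5] by simp
  have l73: "ln (73::real) \<le> 4.297" using ln_pow2_mult_le[of "1.140625" 6] by simp
  have l60: "ln (60::real) \<le> 4.141" using ln_pow2_mult_le[of "1.875" 5] by simp
  consider "y \<le> 5.6" | "5.6 \<le> y" "y \<le> 7.6" | "7.6 \<le> y" "y \<le> 13" | "13 \<le> y" "y \<le> 26"
    | "26 \<le> y" "y \<le> 45" | "45 \<le> y" "y \<le> 60" | "60 \<le> y" by linarith
  then show ?thesis
  proof cases
    case 1
    then show ?thesis unfolding D_def using growth_step_small[OF y _ _ l5 l186] by simp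
  next
    case 2
    then show ?thesis unfolding D_def using growth_step_small[OF _ _ _ l56 l206] by simp
  next
    case 3
    then show ?thesis unfolding D_def using growth_step_small[OF _ _ _ l76, of y 13 "3.281"] l26 by simp
  next
    case 4
    then show ?thesis unfolding D_def using growth_step_small[OF _ _ _ l13, of y 26 "3.670"] l39 by simp
  next
    case 5
    then show ?thesis unfolding D_def using growth_step_small[OF _ _ _ l26, of y 45 "4.101"] l58 by simp
  next
    case 6
    then show ?thesis unfolding D_def using growth_step_small[OF _ _ _ l45, of y 60 "4.297"] l73 by simp
  next
    case 7
    define s where "s = ln y"
    define r where "r = ln (y + 13) + 0.001"
    define v where "v = ln (y / 60)"
    have s0: "0 \<le> s" using 7 by (simp add: s_def)
    have "G y \<le> G 60" using 7 by (intro G_antimono) auto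
    also have "\<dots> \<le> 0.106" using l60 by (simp add: G_def)
    finally have G: "G y \<le> 0.106" .
    have Gy: "y * G y = s + 2.2" using 7 by (simp add: G_def s_def)
    have G0: "0 \<le> G y" using 7 by (simp add: G_def)
    have r13: "r \<le> s + 13 / y + 0.001"
      using ln_diff_le[of "y + 13" y] 7 by (simp add: r_def s_def)
    have "13 / y \<le> 0.217" using 7 by (simp add: field_simps)
    then have r: "r \<le> s + 0.218" using r13 by simp
    have r0: "0 \<le> r" using 7 by (simp add: r_def)
    have D: "D = (1 + G y) * r" by (simp add: D_def r_def)
    have "D \<le> 1.106 * (s + 0.218)"
      unfolding D using G G0 r r0 by (intro mult_mono) auto
    then have D1: "D \<le> 1.106 * s + 0.242" by simp
    have D0: "0 \<le> D" unfolding D using G0 r0 by simp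
    have "y * r \<le> y * (s + 13 / y + 0.001)" using r13 7 by (intro mult_left_mono) auto
    also have "\<dots> = y * s + 13 + 0.001 * y" using 7 by (simp add: field_simps)
    finally have yr: "y * r \<le> y * s + 13 + 0.001 * y" .
    have "(s + 2.2) * r \<le> (s + 2.2) * (s + 0.218)" using r s0 by (intro mult_left_mono) auto
    moreover have "y * D = y * r + (s + 2.2) * r"
      unfolding D Gy[symmetric] by (simp add: algebra_simps)
    ultimately have yD: "y * D \<le> y * s + 13 + 0.001 * y + (s + 2.2) * (s + 0.218)"
      using yr by linarith
    have DD: "D * D \<le> (1.106 * s + 0.242) * (1.106 * s + 0.242)"
      using D0 D1 s0 by (intro mult_mono) auto
    have ey: "y = 60 * exp v" using 7 by (simp add: v_def)
    have v0: "0 \<le> v" using 7 by (simp add: v_def)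
    \<comment> \<open>A quadratic lower bound for \<open>y\<close> in \<open>v = ln (y / 60)\<close>
      is what makes \<open>s * s\<close> comparable with \<open>y\<close>.\<close>
    have "60 * (1 + v + v\<^sup>2 / 2) \<le> y"
      unfolding ey by (intro mult_left_mono exp_lower_Taylor_quadratic v0) auto
    then have "60 + 60 * v + 30 * (v * v) \<le> y" by (simp add: algebra_simps power2_eq_square)
    moreover have "s = ln 60 + v" using 7 by (simp add: s_def v_def ln_div)
    then have sv: "s \<le> 4.141 + v" using l60 by simp
    then have "s * s \<le> (4.141 + v) * (4.141 + v)" using s0 v0 by (intro mult_mono) auto
    then have "500 * (s * s) \<le> 500 * (v * v) + 4141 * v + 8574" by (simp add: field_simps)
    moreover have "0 \<le> v * v" by simp
    ultimately have "2224 * (s * s) \<le> 1199 * y" using v0 by linarith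
    then have "555809 * (s * s) \<le> 299750 * y" using zero_le_square[of s] by linarith
    then have s2: "2.223236 * (s * s) \<le> 1.199 * y" by simp
    have e1: "y * s + 13 + 0.001 * y + (s + 2.2) * (s + 0.218) + y
        + (1.106 * s + 0.242) * (1.106 * s + 0.242) + (1.106 * s + 0.242)
        = y * s + 1.001 * y + 2.223236 * (s * s) + 4.059304 * s + 13.780164"
      by (simp add: field_simps)
    have e2: "(y + 12) * (s + 2.2) = y * s + 2.2 * y + 12 * s + 26.4"
      by (simp add: field_simps)
    have "y * s + 13 + 0.001 * y + (s + 2.2) * (s + 0.218) + y
        + (1.106 * s + 0.242) * (1.106 * s + 0.242) + (1.106 * s + 0.242) \<le> (y + 12) * (s + 2.2)"
      unfolding e1 e2 using s0 s2 by simp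
    moreover have "(D + 1) * (y + D) = y * D + y + D * D + D" by (simp add: algebra_simps)
    ultimately show ?thesis using yD DD D1 by (simp add: s_def)
  qed
qed

section \<open>The induction for the growth rate\<close>

lemma W_increment: "W (Suc n) - W n = W n / lk (Suc n)"
  by (simp add: W_Suc algebra_simps)

lemma W_increase_le:
  fixes c :: real
  assumes "2 \<le> p" "p \<le> m" "0 \<le> c"
    and "\<And>k. p \<le> k \<Longrightarrow> k < m \<Longrightarrow> real k * W k \<le> c * lk (Suc k)"
  shows "W m - W p \<le> c * (ln (real (m - 1)) - ln (real (p - 1)))"
  using assms(2,4)
proof (induction m rule: dec_induct)
  case (step m)
  have m: "real m > 1" "real (lk (Suc m)) > 0" using assms(1) step.hyps lk_ge[of "Suc m"] by auto
  have "W m / lk (Suc m) \<le> c * (1 / real m)"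
    using step.prems[of m] step.hyps m by (simp add: divide_simps mult_ac)
  also have "\<dots> \<le> c * (ln (real m) - ln (real m - 1))"
    using ln_diff_le[of "real m - 1" "real m"] m by (intro mult_left_mono assms(3)) (simp add: field_simps)
  finally have "W (Suc m) - W m \<le> c * (ln (real m) - ln (real m - 1))"
    by (simp add: W_increment)
  moreover have "W m - W p \<le> c * (ln (real (m - 1)) - ln (real (p - 1)))"
    using step by auto
  ultimately show ?case
    using m by (simp add: of_nat_diff algebra_simps)
qed simp

lemma W_increase_ge:
  assumes "1 \<le> p" "p \<le> m"
  shows "ln (real m) - ln (real p) \<le> W m - W p"
  using assms(2)
proof (induction m rule: dec_induct)
  case (step m)
  have m: "0 < real m" "real (lk (Suc m)) > 0" using assms(1) step.hyps lk_ge[of "Suc m"] by auto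
  have "ln (real (Suc m)) - ln (real m) \<le> 1 / real m"
    using ln_diff_le[of "real (Suc m)" "real m"] m by simp
  also have "\<dots> \<le> W m / lk (Suc m)"
    using lk_le_W[of m] m by (simp add: divide_simps mult_ac)
  finally show ?case using step.IH W_increment[of m] by linarith
qed simp

text \<open>For \<open>j > J\<close> the assumption \<open>p0 * W p0 <= J\<close> puts
  \<open>p0\<close> among the candidates for \<open>p\<close>, so the look-back never leaves the
  range \<open>p >= p0\<close>. There \<open>W p >= 18\<close>, which is the condition
  \<open>5 <= y\<close> of \<open>growth_step\<close>.\<close>

lemma growth_bound:
  assumes J: "p0 \<le> J" "p0 * W p0 \<le> J" "W J \<le> 23.1372" and p0: "4000 \<le> p0" "18 \<le> W p0"
    and base: "\<And>j. p0 < j \<Longrightarrow> j \<le> J \<Longrightarrow> real (j - 1) * W (j - 1) \<le> 1.44 * lk j"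
    and j: "p0 < j"
  shows "real (j - 1) * W (j - 1) \<le> (1 + G (W (j - 1) - 13)) * lk j"
  using j
proof (induction j rule: less_induct)
  case (less j)
  have "p0 \<le> j - 1" using less.prems by simp
  then have Wj: "18 \<le> W (j - 1)" using W_mono[of p0 "j - 1"] p0 by linarith
  show ?case
  proof (cases "j \<le> J")
    case True
    then have "W (j - 1) \<le> W J" by (intro W_mono) auto
    \<comment> \<open>10.1372 is 23.1372 - 13. In the window the factor 1.44 is at most
      \<open>1 + G\<close>, because \<open>W\<close> is still small.\<close>
    then have "G 10.1372 \<le> G (W (j - 1) - 13)" using Wj J by (intro G_antimono) auto
    moreover have "0.44 \<le> G 10.1372"
    proof -
      have "ln (8::real) = 3 * ln 2" using ln_realpow[of 2 3] by simp
      moreover have "ln (8::real) + 2 * 2.1372 / (2 * 8 + 2.1372) \<le> ln (8 + 2.1372)"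
        by (rule ln_add_ge) auto
      ultimately have "2.3 \<le> ln (10.1372::real)" using ln_2_ge by simp
      then show ?thesis by (simp add: G_def)
    qed
    ultimately have "1.44 * real (lk j) \<le> (1 + G (W (j - 1) - 13)) * real (lk j)"
      by (intro mult_right_mono) auto
    then show ?thesis using base[OF less.prems True] by linarith
  next
    case False
    define P where "P = {p. p * W p \<le> j}"
    have Pb: "p < j" if "p \<in> P" for p
    proof (cases "p = 0")
      case False
      then have "real p * 2 \<le> real p * W p" using W_ge_2[of p] by (intro mult_left_mono) auto
      then have "real p * 2 \<le> real j" using that unfolding P_def by (elim CollectE) (rule order_trans)
      then show ?thesis using False by simp
    qed (use less.prems in auto)
    then have fin: "finite P" by (meson finite_nat_set_iff_bounded)
    have p0P: "p0 \<in> P" using J(2) False by (simp add: P_def)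
    define p where "p = Max P"
    have p: "p * W p \<le> j" "p < j" "p0 \<le> p"
      using Max_in[OF fin] p0P Pb Max_ge[OF fin p0P] by (auto simp: p_def P_def)
    have "Suc p \<notin> P" using Max_ge[OF fin, of "Suc p"] by (auto simp: p_def)
    then have pS: "j < real (Suc p) * W (Suc p)" by (simp add: P_def)
    define w where "w = W p"
    define y where "y = w - 13"
    define D where "D = (1 + G y) * (ln (y + 13) + 0.001)"
    have w: "18 \<le> w" using W_mono[OF p(3)] p0 by (simp add: w_def)
    then have y: "5 \<le> y" by (simp add: y_def)
    have G0: "0 \<le> G y" using y by (simp add: G_def)
    have pr: "4000 \<le> real p" using p(3) p0 by simp
    \<comment> \<open>The crude \<open>lk (Suc p) >= Suc p\<close> suffices: with the maximality of
      \<open>p\<close> it gives \<open>j <= w * (p + 2)\<close>.\<close>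
    have "W (Suc p) \<le> w * (1 + 1 / real (Suc p))"
      unfolding W_Suc w_def using lk_ge[of "Suc p"] W_pos[of p]
      by (intro mult_left_mono add_left_mono divide_left_mono) auto
    then have "real (Suc p) * W (Suc p) \<le> real (Suc p) * (w * (1 + 1 / real (Suc p)))"
      by (intro mult_left_mono) auto
    also have "\<dots> = w * (real p + 2)" by (simp add: field_simps)
    finally have jw: "real j \<le> w * (real p + 2)" using pS by simp
    have j2: "j \<ge> 4001" using p(2,3) p0(1) by linarith
    have "ln (real (j - 1 - 1)) \<le> ln (w * (real p + 2))"
      using jw j2 by (subst ln_le_cancel_iff) auto
    also have "\<dots> = ln w + ln (real p + 2)" using w by (simp add: ln_mult)
    also have "ln (real p + 2) \<le> ln (real p - 1) + 3 / (real p - 1)"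
      using ln_diff_le[of "real p + 2" "real p - 1"] pr by simp
    \<comment> \<open>This is the 0.001 in \<open>D\<close>, and the reason for
      \<open>4000 <= p0\<close>.\<close>
    also have "3 / (real p - 1) \<le> 0.001" using pr by (simp add: field_simps)
    finally have ln: "ln (real (j - 1 - 1)) - ln (real (p - 1)) \<le> ln (y + 13) + 0.001"
      using p0 p(3) by (simp add: y_def of_nat_diff)
    have "W (j - 1) - W p \<le> (1 + G y) * (ln (real (j - 1 - 1)) - ln (real (p - 1)))"
    proof (rule W_increase_le)
      fix k assume k: "p \<le> k" "k < j - 1"
      have "real k * W k \<le> (1 + G (W k - 13)) * real (lk (Suc k))"
        using less.IH[of "Suc k"] k p(3) by simp
      also have "\<dots> \<le> (1 + G y) * real (lk (Suc k))"
        using y W_mono[OF k(1)] by (intro mult_right_mono add_left_mono G_antimono) (auto simp: y_def w_def)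
      finally show "real k * W k \<le> (1 + G y) * real (lk (Suc k))" .
    qed (use p0 p G0 in auto)
    also have "\<dots> \<le> D" unfolding D_def using ln G0 by (intro mult_left_mono) auto
    finally have WD: "W (j - 1) \<le> w + D" by (simp add: w_def)
    have yD: "1 \<le> W (j - 1) - 13" "W (j - 1) - 13 \<le> y + D" using Wj WD by (auto simp: y_def)
    then have yD0: "0 < y + D" by linarith
    have D0: "0 \<le> D" unfolding D_def using G0 y by simp
    have lkj: "real (j - 1) * (w - 1) \<le> lk j"
    proof -
      have "pos 0 p (j - 1) \<le> lk (Suc (j - 1))" using p j2 by (intro lk_ge_pos) auto
      moreover have "(real (j - 1) + 1 - real p) * W p \<le> pos 0 p (j - 1)"
        using pr by (intro W_le_pos) auto
      ultimately have "(real j - real p) * w \<le> lk j" using j2 by (simp add: w_def of_nat_diff)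
      moreover have "(real j - real p) * w = real j * w - real p * W p"
        by (simp add: w_def algebra_simps)
      ultimately have "real j * w - real j \<le> lk j" using p(1) by linarith
      moreover have "real (j - 1) * (w - 1) \<le> real j * (w - 1)" using w by (intro mult_right_mono) auto
      ultimately show ?thesis by (simp add: algebra_simps)
    qed
    have "(D + 1) * (y + D) \<le> (y + 12) * (ln y + 2.2)"
      unfolding D_def by (rule growth_step[OF y])
    also have "\<dots> \<le> (y + 12) * (ln (y + D) + 2.2)"
      using y D0 by (intro mult_left_mono) auto
    finally have "D + 1 \<le> (y + 12) * G (y + D)"
      using yD0 by (simp add: G_def field_simps)
    also have "\<dots> \<le> (y + 12) * G (W (j - 1) - 13)"
      using y yD by (intro mult_left_mono G_antimono) auto
    finally have "W (j - 1) \<le> (w - 1) * (1 + G (W (j - 1) - 13))"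
      using WD by (simp add: y_def algebra_simps)
    then have "real (j - 1) * W (j - 1) \<le> real (j - 1) * ((w - 1) * (1 + G (W (j - 1) - 13)))"
      by (rule mult_left_mono) simp
    also have "\<dots> = real (j - 1) * (w - 1) * (1 + G (W (j - 1) - 13))" by simp
    also have "\<dots> \<le> lk j * (1 + G (W (j - 1) - 13))"
      using yD by (intro mult_right_mono lkj) (auto simp: G_def)
    finally show ?thesis by (simp add: mult.commute)
  qed
qed

section \<open>Integration of the growth rate and the second bound\<close>

definition bound2 :: "real \<Rightarrow> real" where
  "bound2 x = ln x + 1 / 2 * (ln (ln x))\<^sup>2 + 1.239 * ln (ln x) + 3.016"

text \<open>An antiderivative of \<open>1 + G (t - 7)\<close> for \<open>t = ln n\<close>; since
  \<open>W n >= ln n + 6\<close>, the argument \<open>W n - 13\<close> of \<open>G\<close> is at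
  least \<open>t - 7\<close>.\<close>

definition Theta :: "real \<Rightarrow> real" where
  "Theta t = t + 1 / 2 * (ln (t - 7))\<^sup>2 + 2.2 * ln (t - 7)"

lemma Theta_deriv:
  assumes "8 \<le> t"
  shows "(Theta has_real_derivative 1 + G (t - 7)) (at t)"
proof -
  have d: "((\<lambda>t. ln (t - 7)) has_real_derivative 1 / (t - 7)) (at t)"
    using assms by (auto intro!: derivative_eq_intros)
  have p: "((\<lambda>t. (ln (t - 7))\<^sup>2) has_real_derivative 2 * (ln (t - 7) * (1 / (t - 7)))) (at t)"
    using DERIV_power[OF d, of 2] by (simp add: mult_ac)
  have "(Theta has_real_derivative 1 + 1 / 2 * (2 * (ln (t - 7) * (1 / (t - 7)))) + 2.2 * (1 / (t - 7))) (at t)"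
    unfolding Theta_def[abs_def] by (intro DERIV_add DERIV_ident DERIV_cmult p d)
  moreover have "1 + 1 / 2 * (2 * (l * (1 / u))) + 2.2 * (1 / u) = 1 + (l + 2.2) / u" for l u :: real
    by (simp add: add_divide_distrib)
  ultimately show ?thesis unfolding G_def by metis
qed

lemma Theta_diff_ge:
  assumes "8 \<le> a" "a \<le> b"
  shows "(1 + G (b - 7)) * (b - a) \<le> Theta b - Theta a"
proof (cases "a = b")
  case False
  then have ab: "a < b" using assms by simp
  obtain z where z: "a < z" "z < b" "Theta b - Theta a = (b - a) * (1 + G (z - 7))"
    using MVT2[OF ab, of Theta "\<lambda>t. 1 + G (t - 7)"] Theta_deriv assms by auto
  have "G (b - 7) \<le> G (z - 7)" using z assms by (intro G_antimono) auto
  then show ?thesis using z ab by (simp add: mult.commute mult_left_mono)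
qed simp

lemma exp_le_power: "exp (real k) \<le> 2.72 ^ k"
proof -
  have "ln (2.72::real) = ln 2 + ln (1 + 0.36)" by (subst ln_mult_pos[symmetric]) auto
  then have "1 \<le> ln (2.72::real)"
    using ln_2_ge ln_add_ge3[of 1 "0.36"] by (simp add: power3_eq_cube)
  then have e: "exp 1 \<le> (2.72::real)" by (subst (asm) ln_ge_iff) auto
  have "exp (real k) = exp 1 ^ k" by (simp add: exp_of_nat_mult[symmetric])
  also have "\<dots> \<le> 2.72 ^ k" using e by (intro power_mono) auto
  finally show ?thesis .
qed

lemma W_le_Theta:
  assumes J: "J = 3676350" "21.3002 \<le> W J"
    and gr: "\<And>k. J \<le> k \<Longrightarrow> real k * W k \<le> (1 + G (W k - 13)) * lk (Suc k)"
    and i: "J \<le> i"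
  shows "W i \<le> W J + Theta (ln (real (i - 1))) - Theta (ln (real (J - 1)))"
    and "ln (real i) + 6 \<le> W i"
proof -
  have lnJ1: "15 \<le> ln (real (J - 1))"
  proof -
    have "exp 15 \<le> (2.72 :: real) ^ 15" using exp_le_power[of 15] by simp
    also have "\<dots> \<le> 3676349" by (simp add: power_divide)
    finally show ?thesis using J by (subst ln_ge_iff) auto
  qed
  have lnJ: "ln (real J) \<le> 15.3"
  proof -
    have "ln (real J) \<le> ln (2 ^ 22 * 1)" unfolding J by (subst ln_le_cancel_iff) auto
    then show ?thesis using ln_pow2_mult_le[of 1 22] by simp
  qed
  \<comment> \<open>The 6 comes from 21.3002 - 15.3 at \<open>J\<close>; after \<open>J\<close> the
    product grows at least as fast as \<open>ln\<close>.\<close>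
  have low: "ln (real k) + 6 \<le> W k" if "J \<le> k" for k
    using W_increase_ge[of J k] that J lnJ by simp
  then show "ln (real i) + 6 \<le> W i" using i .
  show "W i \<le> W J + Theta (ln (real (i - 1))) - Theta (ln (real (J - 1)))"
    using i
  proof (induction i rule: dec_induct)
    case (step m)
    let ?l = "ln (real m)" and ?l' = "ln (real (m - 1))"
    have m: "real m > 2" "lk (Suc m) > 0" using step.hyps J lk_ge[of "Suc m"] by auto
    have l': "15 \<le> ?l'" "?l' \<le> ?l"
      using lnJ1 step.hyps J(1) ln_le_cancel_iff[of "real (J - 1)" "real (m - 1)"] by (auto intro: order_trans)
    have "real m * W m \<le> (1 + G (W m - 13)) * lk (Suc m)"
      using gr step.hyps by simp
    also have "\<dots> \<le> (1 + G (?l - 7)) * lk (Suc m)"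
      using low[OF step.hyps(1)] l' by (intro mult_right_mono add_left_mono G_antimono) auto
    finally have "W (Suc m) - W m \<le> (1 + G (?l - 7)) * (1 / real m)"
      unfolding W_increment using m by (simp add: divide_simps mult_ac)
    also have "\<dots> \<le> (1 + G (?l - 7)) * (?l - ?l')"
    proof (intro mult_left_mono)
      show "1 / real m \<le> ?l - ?l'"
        using ln_diff_le[of "real m - 1" "real m"] m by (simp add: of_nat_diff field_simps)
      show "0 \<le> 1 + G (?l - 7)" using l' by (simp add: G_def)
    qed
    also have "\<dots> \<le> Theta ?l - Theta ?l'" using l' by (intro Theta_diff_ge) auto
    finally show ?case using step.IH by simp
  qed simp
qed

text \<open>Up to \<open>J\<close> the product stays below 24, which the bound exceeds for
  \<open>n > 10^7\<close>. For later \<open>i\<close>, with \<open>L = ln (i - 1)\<close>,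
  \<open>Theta\<close> gives \<open>W i <= L + (ln L)^2 / 2 + 2.2 * ln L + 1.6\<close>, and
  \<open>L + ln L - 0.6 <= ln n\<close> turns this into a bound in \<open>n\<close>.\<close>

lemma W_less_bound2:
  assumes J: "J = 3676350" "21.3002 \<le> W J" "W J \<le> 23.1372"
    and gr: "\<And>k. J \<le> k \<Longrightarrow> real k * W k \<le> (1 + G (W k - 13)) * lk (Suc k)"
    and n: "10 ^ 7 < n" "lucky i \<le> n" "1 \<le> i"
  shows "W i < bound2 (real n)"
proof (cases "i \<le> J")
  case True
  have "exp 16 \<le> (2.72 :: real) ^ 16" using exp_le_power[of 16] by simp
  also have "\<dots> \<le> 10 ^ 7" by (simp add: power_divide)
  finally have "16 \<le> ln (10 ^ 7 :: real)" by (subst ln_ge_iff) auto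
  also have "\<dots> \<le> ln (real n)" using n(1) by (subst ln_le_cancel_iff) auto
  finally have l: "16 \<le> ln (real n)" .
  have "ln (16::real) = 4 * ln 2" using ln_realpow[of 2 4] by simp
  moreover have "ln 16 \<le> ln (ln (real n))" using l by simp
  ultimately have ll: "2.7 \<le> ln (ln (real n))" using ln_2_ge by simp
  then have "2.7\<^sup>2 \<le> (ln (ln (real n)))\<^sup>2" by (intro power_mono) auto
  then have "24 \<le> bound2 (real n)" using l ll by (simp add: bound2_def power2_eq_square)
  then show ?thesis using W_mono[OF True] J by simp
next
  case False
  define m where "m = i - 1"
  have m: "J \<le> m" "i = Suc m" using False by (auto simp: m_def)
  let ?L = "ln (real m)"
  have "exp 15 \<le> (2.72 :: real) ^ 15" using exp_le_power[of 15] by simp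
  also have "\<dots> \<le> 3676349" by (simp add: power_divide)
  finally have e15: "exp 15 \<le> (3676349 :: real)" .
  have L15: "15 \<le> ln (real (J - 1))" using J e15 by (subst ln_ge_iff) auto
  have L: "15 \<le> ?L" using J(1) m e15 by (subst ln_ge_iff) auto
  have ln8: "2.07 \<le> ln (8 :: real)" using ln_realpow[of 2 3] ln_2_ge by simp
  also have "\<dots> \<le> ln (ln (real (J - 1)) - 7)" using L15 by simp
  finally have l8: "2.07 \<le> ln (ln (real (J - 1)) - 7)" .
  then have "2.07\<^sup>2 \<le> (ln (ln (real (J - 1)) - 7))\<^sup>2" by (intro power_mono) auto
  then have "21.6 \<le> Theta (ln (real (J - 1)))"
    using l8 L15 by (simp add: Theta_def power2_eq_square)
  \<comment> \<open>23.1372 - 21.6 is below 1.6.\<close>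
  then have "W i \<le> 1.6 + Theta ?L"
    using W_le_Theta(1)[OF J(1,2) gr, of i] m J by simp
  moreover have "Theta ?L \<le> ?L + 1 / 2 * (ln ?L)\<^sup>2 + 2.2 * ln ?L"
    unfolding Theta_def using L by (intro add_mono mult_left_mono power_mono) auto
  ultimately have Wi: "W i \<le> ?L + 1 / 2 * (ln ?L)\<^sup>2 + 2.2 * ln ?L + 1.6" by simp
  have Wm: "?L + 6 \<le> W m" by (rule W_le_Theta(2)[OF J(1,2) gr m(1)])
  have "G (W m - 13) \<le> G 8" using Wm L by (intro G_antimono) auto
  also have "\<dots> \<le> 0.6" using ln_pow2_mult_le[of 1 3] by (simp add: G_def)
  finally have "(1 + G (W m - 13)) * lk i \<le> 1.6 * lk i" by (intro mult_right_mono) auto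
  \<comment> \<open>The growth bound, read as a lower bound for \<open>lk i\<close>, shows that
    \<open>n\<close> exceeds \<open>m\<close> by at least a factor \<open>L / 1.6\<close>.\<close>
  then have "real m * W m \<le> 1.6 * lk i" using gr[OF m(1)] unfolding m(2) by (rule order_trans[rotated])
  moreover have "real m * ?L \<le> real m * W m" using Wm by (intro mult_left_mono) auto
  moreover have "lk i \<le> n" using n by (simp add: lucky_lk)
  ultimately have "real m * ?L \<le> 1.6 * real n" by linarith
  moreover have mpos: "0 < real m" using J(1) m(1) by simp
  moreover from this have "0 < real m * ?L" using L mult_pos_pos[of "real m" ?L] by linarith
  ultimately have "ln (real m * ?L) \<le> ln (1.6 * real n)"
    by (subst ln_le_cancel_iff) auto
  also have "\<dots> = ln 1.6 + ln (real n)" using n by (subst ln_mult_pos) auto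
  also have "ln (1.6::real) \<le> 0.6" using ln_le_minus_one[of "1.6::real"] by simp
  finally have "ln (real m * ?L) \<le> 0.6 + ln (real n)" by simp
  moreover have "ln (real m * ?L) = ?L + ln ?L" using L by (intro ln_mult_pos mpos) linarith
  ultimately have M: "?L + ln ?L - 0.6 \<le> ln (real n)" by simp
  have "ln 8 \<le> ln ?L" using L by simp
  then have lL: "2.07 \<le> ln ?L" using ln8 by linarith
  then have "?L \<le> ln (real n)" using M by simp
  then have "ln ?L \<le> ln (ln (real n))" using L by simp
  moreover from this have "(ln ?L)\<^sup>2 \<le> (ln (ln (real n)))\<^sup>2" using lL by (intro power_mono) auto
  ultimately have "?L + ln ?L - 0.6 + 1 / 2 * (ln ?L)\<^sup>2 + 1.239 * ln ?L + 3.016 \<le> bound2 (real n)"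
    unfolding bound2_def using M by (intro add_mono mult_left_mono) auto
  then show ?thesis using Wi lL by simp
qed

lemma lucky_bracket:
  assumes "2 \<le> n"
  obtains i where "1 \<le> i" "lucky i \<le> n" "n < lucky (Suc i)"
proof -
  define P where "P = {i. 1 \<le> i \<and> lucky i \<le> n}"
  have "i < n" if "i \<in> P" for i
    using that lk_ge[of i] by (auto simp: P_def lucky_lk)
  then have fin: "finite P" by (meson finite_nat_set_iff_bounded)
  have one: "1 \<in> P" using assms lucky_1 by (simp add: P_def)
  have "Max P \<in> P" using fin one by (intro Max_in) auto
  moreover have "Suc (Max P) \<notin> P" using Max_ge[OF fin, of "Suc (Max P)"] by auto
  ultimately show thesis using that[of "Max P"] by (auto simp: P_def)
qed

section \<open>The bounds for lucky numbers\<close>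

lemma hd_rows:
  "hd rows1 = Row 62 1 330 330 331 2 802450 802511 15 1"
  "hd rows5 = Row 642057 33472 10195918 10907376 9657198 13 1940886 2083379 49150 3389"
  "hd rows6 = Row 3676350 240508 65384731 70661158 60675501 15 2130029 2313719 258399 15973"
  by (simp_all only: rows1_def rows5_def rows6_def list.sel)

lemma rows_ok_rows:
  "\<forall>r \<in> set rows1. row_ok r" "\<forall>r \<in> set rows5. row_ok r" "\<forall>r \<in> set rows6. row_ok r"
  using valid_row_ok valid_rows1 valid_rows5 valid_rows6 by blast+

lemma W_last: "21.3002 \<le> W 3676350" "W 3676350 \<le> 23.1372"
proof -
  have "row_ok (hd rows6)"
    by (rule valid_row_ok[OF valid_rows6]) (simp only: rows6_def list.sel list.set_intros)
  then show "21.3002 \<le> W 3676350" "W 3676350 \<le> 23.1372" by (simp_all add: hd_rows)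
qed

text \<open>The first bound gives \<open>5 <= y\<close> at the start of the induction window, the
  second gives \<open>187404 * W 187404 <= 3676350\<close>, the window's end.\<close>

lemma W_187404: "18.03 \<le> W 187404" "W 187404 \<le> 19.21"
proof -
  have "Row 187404 9769 2734929 2897835 2587213 11 1803270 1920218 15973 1107 \<in> set rows5"
    by (simp only: rows5_def list.set insert_iff simp_thms)
  then have "row_ok (Row 187404 9769 2734929 2897835 2587213 11 1803270 1920218 15973 1107)"
    by (rule valid_row_ok[OF valid_rows5])
  then show "18.03 \<le> W 187404" "W 187404 \<le> 19.21" by simp_all
qed

lemma lk_15_le: "lk 15 \<le> 62"
proof -
  have "Row 15 1 62 62 63 2 593043 593054 6 1 \<in> set rows1"
    by (simp only: rows1_def list.set insert_iff simp_thms)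
  then have "row_ok (Row 15 1 62 62 63 2 593043 593054 6 1)"
    by (rule valid_row_ok[OF valid_rows1])
  then show ?thesis by simp
qed

lemma lk_642057_ge: "10 ^ 7 \<le> lk 642057"
proof -
  have "row_ok (hd rows5)"
    by (rule valid_row_ok[OF valid_rows5]) (simp only: rows5_def list.sel list.set_intros)
  then show ?thesis by (simp add: hd_rows)
qed

lemma lucky_less_bound1_upto:
  assumes "4 \<le> n" "n \<le> 10 ^ 7"
  shows "real (lucky n) < real n * bound1 (real n)"
proof (cases "n \<le> 62")
  case True
  then show ?thesis
    using check_small_sound[OF check_small_rows rows_ok_rows(1)] assms by (simp add: hd_rows)
next
  case False
  obtain i where i: "1 \<le> i" "lucky i \<le> n" "n < lucky (Suc i)"
    using lucky_bracket[of n] assms by auto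
  have "15 \<le> i"
  proof (rule ccontr)
    assume "\<not> 15 \<le> i"
    then have "lk (Suc i) \<le> lk 15" by (intro lk_mono) auto
    then show False using i(3) lk_15_le False by (simp add: lucky_lk)
  qed
  moreover have "i < 642057"
  proof (rule ccontr)
    assume "\<not> i < 642057"
    then have "lk 642057 \<le> lk i" by (intro lk_mono) auto
    then show False using i(1,2) lk_642057_ge assms(2) by (simp add: lucky_lk)
  qed
  ultimately have "W i \<le> bound1 (real n)"
    using check_blocks_sound[OF check_blocks_rows rows_ok_rows(2)] i(2) by (simp add: hd_rows)
  then have "real n * W i \<le> real n * bound1 (real n)" by (rule mult_left_mono) simp
  moreover have "lucky n < real n * W i"
    by (rule lucky_less_W[OF _ i(1,3)]) (use assms in simp)
  ultimately show ?thesis by linarith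
qed

lemma growth_bound_from_187404:
  assumes "3676350 \<le> k"
  shows "real k * W k \<le> (1 + G (W k - 13)) * lk (Suc k)"
proof -
  have "real (Suc k - 1) * W (Suc k - 1) \<le> (1 + G (W (Suc k - 1) - 13)) * lk (Suc k)"
  proof (rule growth_bound[where J = 3676350 and ?p0.0 = 187404])
    fix j :: nat assume "187404 < j" "j \<le> 3676350"
    then show "real (j - 1) * W (j - 1) \<le> 1.44 * lk j"
      using check_growth_sound[OF check_growth_rows rows_ok_rows(3), of j] by (simp add: hd_rows)
  qed (use W_187404 W_last assms in simp_all)
  then show ?thesis by simp
qed

lemma lucky_less_bound2:
  assumes "10 ^ 7 < n"
  shows "real (lucky n) < real n * bound2 (real n)"
proof -
  obtain i where i: "1 \<le> i" "lucky i \<le> n" "n < lucky (Suc i)"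
    using lucky_bracket[of n] assms by auto
  have "W i < bound2 (real n)"
    by (rule W_less_bound2[OF refl W_last growth_bound_from_187404 assms i(2,1)])
  then have "real n * W i \<le> real n * bound2 (real n)" by (intro mult_left_mono) auto
  moreover have "lucky n < real n * W i"
    by (rule lucky_less_W[OF _ i(1,3)]) (use assms in simp)
  ultimately show ?thesis by linarith
qed

theorem theorem1p2:
  "(\<forall>n::nat. 4 \<le> n \<and> n \<le> 10 ^ 7 \<longrightarrow>
      real (lucky n) < real n * (ln (real n) + 1 / 2 * (ln (ln (real n)))\<^sup>2 + 1)) \<and>
   (\<forall>n::nat. n > 10 ^ 7 \<longrightarrow>
      real (lucky n) < real n * (ln (real n) + 1 / 2 * (ln (ln (real n)))\<^sup>2
                                 + 1.239 * ln (ln (real n)) + 3.016))"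
  using lucky_less_bound1_upto lucky_less_bound2 unfolding bound1_def bound2_def by blast

end
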